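(* Let $4\leq d\leq n-2$ and let $G$ be a unicyclic graph with $n$ vertices and diameter $d$. Then $$SO_{1}(G)\leq \frac{1}{2}\big[(n-d)(n-d+1)(n-d+2)+12\big],$$ with equality if and only if $G\cong U_{n,d}^{i}$ for some $i\in\{1,2,\ldots,d-3\}$.
   Context: All graphs are finite and simple. A unicyclic graph is a connected graph with exactly one cycle. For a graph $G$, $d_u$ is the degree of the vertex $u$, and $SO_{1}(G)=\frac{1}{2}\sum_{uv\in E(G)}|d_{u}^{2}-d_{v}^{2}|$. The tree $T_{n,d}^{i}$ is obtained from the path $v_{0}v_{1}\cdots v_{d}$ by attaching $n-d-1$ pendent edges $v_iu_1,\ldots,v_iu_{n-d-1}$ (with new vertices $u_1,\dots,u_{n-d-1}$) to the vertex $v_{i}$. The graph $U_{n,d}^{i}$ is obtained from $T_{n,d}^{i}$ by adding the edge $u_{n-d-1}v_{i+2}$. *)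

theory Defs
  imports "Graph_Theory.Graph_Theory"
begin

text \<open>
  A finite simple graph is a \<^locale>\<open>pair_graph\<close>: a finite loopfree symmetric
  digraph whose arcs are vertex pairs.  Every edge $uv$ is thus represented by the two arcs
  $(u,v)$ and $(v,u)$, and the degree of a vertex is its out-degree.
\<close>

abbreviation degree :: "'a pair_pre_digraph \<Rightarrow> 'a \<Rightarrow> nat" where
  "degree G u \<equiv> out_degree (with_proj G) u"

text \<open>The inner division by 2 compensates for every edge occurring as two arcs.\<close>

definition SO1 :: "'a pair_pre_digraph \<Rightarrow> real" where
  "SO1 G = 1 / 2 *
     ((\<Sum>(u, v)\<in>parcs G. \<bar>(real (degree G u))\<^sup>2 - (real (degree G v))\<^sup>2\<bar>) / 2)"

text \<open>
  Cycles as subgraphs, identified with their sets of undirected edges, so that neither the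
  starting vertex nor the orientation matters.  The library's cycles are closed directed walks;
  the length bound excludes going back and forth along a single edge.
\<close>

definition cycle_edge_sets :: "'a pair_pre_digraph \<Rightarrow> 'a set set set" where
  "cycle_edge_sets G =
     {(\<lambda>(u, v). {u, v}) ` set p | p. pre_digraph.cycle (with_proj G) p \<and> 3 \<le> length p}"

definition unicyclic :: "'a pair_pre_digraph \<Rightarrow> bool" where
  "unicyclic G \<longleftrightarrow>
     pair_graph G \<and> Digraph_Component.connected (with_proj G) \<and> (\<exists>!C. C \<in> cycle_edge_sets G)"

definition distance :: "'a pair_pre_digraph \<Rightarrow> 'a \<Rightarrow> 'a \<Rightarrow> ereal" where
  "distance G u v = wf_digraph.\<mu> (with_proj G) (\<lambda>_. 1) u v"

definition diameter :: "'a pair_pre_digraph \<Rightarrow> ereal" where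
  "diameter G = (SUP u\<in>pverts G. SUP v\<in>pverts G. distance G u v)"

text \<open>\<open>PathV j\<close> is $v_j$ and \<open>PendV k\<close> is $u_k$.\<close>

datatype vertex = PathV nat | PendV nat

definition add_edge :: "'a \<Rightarrow> 'a \<Rightarrow> 'a pair_pre_digraph \<Rightarrow> 'a pair_pre_digraph" where
  "add_edge u v G = G\<lparr>parcs := parcs G \<union> {(u, v), (v, u)}\<rparr>"

definition T_graph :: "nat \<Rightarrow> nat \<Rightarrow> nat \<Rightarrow> vertex pair_pre_digraph" where
  "T_graph n d i =
     (let E = {(PathV j, PathV (j + 1)) | j. j < d}
            \<union> {(PathV i, PendV k) | k. k \<in> {1..n - d - 1}}
      in \<lparr>pverts = PathV ` {0..d} \<union> PendV ` {1..n - d - 1}, parcs = E \<union> E\<inverse>\<rparr>)"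

definition U_graph :: "nat \<Rightarrow> nat \<Rightarrow> nat \<Rightarrow> vertex pair_pre_digraph" where
  "U_graph n d i = add_edge (PendV (n - d - 1)) (PathV (i + 2)) (T_graph n d i)"

end

theory Submission
  imports Defs
begin

text \<open>
  Put \<open>m = n - d\<close>.  A unicyclic graph has \<open>n\<close> edges, so \<open>\<Sum>(d\<^sub>v - 2) = 0\<close> and the degree excess above 2 is
  spent by the leaves.  Comparing with a geodesic of length \<open>d\<close>, which misses only \<open>m - 1\<close>
  vertices, shows that all degrees are at most \<open>m + 1\<close> and that there are at most \<open>m\<close> leaves: since \<open>m\<close>
  edges lie off the geodesic, some vertex off it is not a leaf.

  The contribution of an edge \<open>uv\<close> is at most \<open>h(d\<^sub>u) + h(d\<^sub>v)\<close> with \<open>h(1) = 3\<close> and \<open>h(k) = k\<^sup>2 - 4\<close>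
  otherwise, so \<open>2 SO\<^sub>1 \<le> \<Sum> d\<^sub>v h(d\<^sub>v)\<close>, with equality only if no two vertices of degree at least 3 are
  adjacent.  By convexity the sum is largest when there are \<open>m\<close> leaves and the remaining excess \<open>m\<close> is
  split as \<open>(m - 1) + 1\<close>, which gives the bound.  In the case of equality there are a vertex of degree
  \<open>m + 1\<close> and one of degree 3, not adjacent, and exactly one nonleaf \<open>w\<close> off the geodesic; \<open>w\<close> must join
  these two vertices, which therefore lie at distance 2 on the geodesic, and all other vertices off
  the geodesic hang from the first one.
\<close>

section \<open>Counting edges by cycles\<close>

text \<open>Serves the induction in \<open>ex_vertex_cycle\<close>: deleting a vertex of degree at
  most 1 destroys at most two arcs.\<close>

lemma card_arcs_vertex:
  assumes "finite E" "sym E"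
  shows "card {e \<in> E. fst e = v \<or> snd e = v} \<le> 2 * card (E `` {v})"
proof -
  have "{e \<in> E. fst e = v \<or> snd e = v} \<subseteq> Pair v ` (E `` {v}) \<union> (\<lambda>x. (x, v)) ` (E `` {v})"
    using symD[OF assms(2)] by force
  moreover have f: "finite (E `` {v})" using assms(1) by (rule finite_Image)
  ultimately have "card {e \<in> E. fst e = v \<or> snd e = v}
      \<le> card (Pair v ` (E `` {v}) \<union> (\<lambda>x. (x, v)) ` (E `` {v}))"
    by (intro card_mono) auto
  also have "\<dots> \<le> card (Pair v ` (E `` {v})) + card ((\<lambda>x. (x, v)) ` (E `` {v}))"
    by (rule card_Un_le)
  also have "\<dots> \<le> card (E `` {v}) + card (E `` {v})"
    using f by (intro add_mono card_image_le)
  finally show ?thesis by simp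
qed

text \<open>The first vertex of a longest path has two neighbours, and both lie on the path.\<close>

lemma ex_vertex_cycle_min_degree:
  assumes fin: "finite V" and E: "E \<subseteq> V \<times> V" "sym E" "irrefl E" and ne: "V \<noteq> {}"
    and deg: "\<And>v. v \<in> V \<Longrightarrow> 2 \<le> card (E `` {v})"
  shows "\<exists>xs. 3 \<le> length xs \<and> distinct xs \<and> set (vwalk_arcs (xs @ [hd xs])) \<subseteq> E"
proof -
  define P where "P xs \<longleftrightarrow> xs \<noteq> [] \<and> distinct xs \<and> set xs \<subseteq> V \<and> set (vwalk_arcs xs) \<subseteq> E" for xs
  obtain v where v: "v \<in> V" using ne by auto
  have "P [v]" using v by (simp add: P_def)
  moreover have "\<forall>xs. P xs \<longrightarrow> length xs < Suc (card V)"
  proof (intro allI impI)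
    fix xs assume "P xs"
    then have "card (set xs) = length xs" "set xs \<subseteq> V" by (auto simp: P_def distinct_card)
    then show "length xs < Suc (card V)" using card_mono[OF fin, of "set xs"] by simp
  qed
  ultimately have "\<exists>xs. P xs \<and> (\<forall>ys. P ys \<longrightarrow> length ys \<le> length xs)"
    by (rule ex_has_greatest_nat)
  then obtain xs where xs: "P xs" and max: "\<And>ys. P ys \<Longrightarrow> length ys \<le> length xs" by metis
  obtain y ys where y: "xs = y # ys" using xs by (cases xs) (auto simp: P_def)
  have nbr: "z \<in> set ys" if "(y, z) \<in> E" for z
  proof (rule ccontr)
    assume "z \<notin> set ys"
    moreover have "z \<noteq> y" using that E(3) by (auto simp: irrefl_def)
    ultimately have "P (z # xs)"
      using xs that E symD[OF E(2) that] unfolding P_def y by (auto simp: y)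
    then show False using max[of "z # xs"] by simp
  qed
  have c2: "2 \<le> card (E `` {y})" using deg xs by (auto simp: P_def y)
  \<comment> \<open>A neighbour of \<open>y\<close> other than the second path vertex is wanted, so
    that closing the path there gives a cycle of length at least 3.\<close>
  then have "\<not> E `` {y} \<subseteq> {hd ys}" using card_mono[of "{hd ys}" "E `` {y}"] by auto
  then obtain z where z: "(y, z) \<in> E" "z \<noteq> hd ys" by auto
  obtain as bs where split: "ys = as @ z # bs" using split_list[OF nbr[OF z(1)]] by blast
  have as: "as \<noteq> []" using z(2) split by auto
  have "set (vwalk_arcs (y # as @ [z])) \<subseteq> E"
    using xs set_vwalk_arcs_append1[of "y # as @ [z]" bs] unfolding P_def y split by auto
  then have "set (vwalk_arcs ((y # as @ [z]) @ [y])) \<subseteq> E"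
    using symD[OF E(2) z(1)] by (subst set_vwalk_arcs_snoc) auto
  moreover have "distinct (y # as @ [z])" using xs by (auto simp: P_def y split)
  moreover have "3 \<le> length (y # as @ [z])" using as by (cases as) auto
  ultimately show ?thesis by (intro exI[of _ "y # as @ [z]"]) simp
qed

text \<open>Vertices of degree at most 1 are deleted one by one until the minimum degree is 2. The
  \<open>+ 1\<close> avoids a parity argument: removing one edge from more than
  \<open>2 * card V\<close> arcs leaves, by mere counting, at least
  \<open>2 * card V - 1\<close>.\<close>

lemma ex_vertex_cycle:
  assumes "finite V" "E \<subseteq> V \<times> V" "sym E" "irrefl E" "V \<noteq> {}" "2 * card V \<le> card E + 1"
  shows "\<exists>xs. 3 \<le> length xs \<and> distinct xs \<and> set (vwalk_arcs (xs @ [hd xs])) \<subseteq> E"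
  using assms
proof (induction "card V" arbitrary: V E)
  case 0 then show ?case by auto
next
  case (Suc k)
  note prems = Suc.prems
  have finE: "finite E" using prems(1,2) finite_subset by blast
  show ?case
  proof (cases "\<exists>v\<in>V. card (E `` {v}) \<le> 1")
    case False
    then have "2 \<le> card (E `` {v})" if "v \<in> V" for v
      using that by (metis Suc_1 not_less_eq_eq)
    then show ?thesis using prems(1-5) by (intro ex_vertex_cycle_min_degree[of V])
  next
    case True
    then obtain v where v: "v \<in> V" "card (E `` {v}) \<le> 1" by blast
    define I where "I = {e \<in> E. fst e = v \<or> snd e = v}"
    have I: "card I \<le> 2" using card_arcs_vertex[OF finE prems(3), of v] v(2) by (simp add: I_def)
    have "card (E - I) = card E - card I" using finE by (intro card_Diff_subset) (auto simp: I_def)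
    moreover have cV: "card (V - {v}) = k" using Suc.hyps(2) v(1) prems(1) by simp
    ultimately have "2 * card (V - {v}) \<le> card (E - I) + 1"
      using prems(6) Suc.hyps(2) I by simp
    moreover have "V - {v} \<noteq> {}"
    proof
      assume "V - {v} = {}"
      then have "V = {v}" using v by auto
      then have "E = {}" using prems(2,4) by (auto simp: irrefl_def)
      then show False using prems(6) \<open>V = {v}\<close> by simp
    qed
    moreover have "E - I \<subseteq> (V - {v}) \<times> (V - {v})" using prems(2) by (auto simp: I_def)
    moreover have "sym (E - I)" using prems(3) by (auto simp: I_def sym_def)
    moreover have "irrefl (E - I)" using prems(4) by (auto simp: irrefl_def)
    ultimately obtain xs where "3 \<le> length xs" "distinct xs"
        "set (vwalk_arcs (xs @ [hd xs])) \<subseteq> E - I"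
      using Suc.hyps(1)[of "V - {v}" "E - I"] cV prems(1) by auto
    then show ?thesis by blast
  qed
qed

lemma pcas_vwalk_arcs: "xs \<noteq> [] \<Longrightarrow> pcas (hd xs) (vwalk_arcs xs) (last xs)"
  by (induction xs rule: vwalk_arcs.induct) auto

lemma pawalk_verts_vwalk_arcs: "xs \<noteq> [] \<Longrightarrow> pawalk_verts (hd xs) (vwalk_arcs xs) = xs"
  by (induction xs rule: vwalk_arcs.induct) auto

context pair_graph begin

text \<open>Translates a closed list of vertices into a cycle in the sense of the library, which is
  a list of arcs.\<close>

lemma cycle_vwalk_arcs:
  assumes "3 \<le> length xs" "distinct xs" "set (vwalk_arcs (xs @ [hd xs])) \<subseteq> parcs G"
  shows "cycle (vwalk_arcs (xs @ [hd xs]))"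
proof -
  obtain x ys where xs: "xs = x # ys" and ys: "ys \<noteq> []"
    using assms(1) by (cases xs) fastforce+
  have "(x, hd ys) \<in> parcs G" using assms(3) ys by (simp add: xs)
  then have "x \<in> pverts G" by (rule in_arcsD1)
  then show ?thesis
    using assms pcas_vwalk_arcs[of "xs @ [x]"] pawalk_verts_vwalk_arcs[of "xs @ [x]"]
    unfolding cycle_def awalk_def by (intro exI[of _ x]) (auto simp: xs)
qed

lemma vwalk_cycle_in_cycle_edge_sets:
  assumes "3 \<le> length xs" "distinct xs" "set (vwalk_arcs (xs @ [hd xs])) \<subseteq> parcs G"
  shows "(\<lambda>(u, v). {u, v}) ` set (vwalk_arcs (xs @ [hd xs])) \<in> cycle_edge_sets G"
proof -
  have "length (vwalk_arcs (xs @ [hd xs])) = length xs"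
    using vwalk_length_simp[of "xs @ [hd xs]"] unfolding vwalk_length_def by simp
  with assms cycle_vwalk_arcs show ?thesis unfolding cycle_edge_sets_def by fastforce
qed

text \<open>Delete one edge of the unique cycle. With too many arcs, enough remain to force a cycle
  that avoids this edge and hence has a different edge set.\<close>

lemma card_arcs_le_if_unique_cycle:
  assumes "\<exists>!C. C \<in> cycle_edge_sets G"
  shows "card (parcs G) \<le> 2 * card (pverts G)"
proof (rule ccontr)
  assume many: "\<not> card (parcs G) \<le> 2 * card (pverts G)"
  obtain C where C: "C \<in> cycle_edge_sets G" and uniq: "\<And>D. D \<in> cycle_edge_sets G \<Longrightarrow> D = C"
    using assms by blast
  then obtain p where p: "cycle p" "3 \<le> length p" "C = (\<lambda>(u, v). {u, v}) ` set p"
    unfolding cycle_edge_sets_def by blast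
  then obtain x y where xy: "(x, y) \<in> set p" by (cases p) auto
  then have arc: "(x, y) \<in> parcs G" using p(1) unfolding cycle_def awalk_def by blast
  define E where "E = parcs G - {(x, y), (y, x)}"
  have "card (parcs G) - card {(x, y), (y, x)} \<le> card E"
    unfolding E_def by (intro diff_card_le_card_Diff) auto
  moreover have "card {(x, y), (y, x)} \<le> 2"
    using card_length[of "[(x, y), (y, x)]"] by simp
  ultimately have "2 * card (pverts G) \<le> card E + 1" using many by linarith
  moreover have "E \<subseteq> pverts G \<times> pverts G" by (auto simp: E_def in_arcsD1 in_arcsD2)
  moreover have "sym E" unfolding E_def sym_def using arcs_symmetric by blast
  moreover have "irrefl E" using no_loops' by (auto simp: E_def irrefl_def)
  moreover have "pverts G \<noteq> {}" using in_arcsD1[OF arc] by auto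
  ultimately obtain xs where xs: "3 \<le> length xs" "distinct xs"
      "set (vwalk_arcs (xs @ [hd xs])) \<subseteq> E"
    using ex_vertex_cycle[of "pverts G" E] pair_finite_verts by blast
  then have "(\<lambda>(u, v). {u, v}) ` set (vwalk_arcs (xs @ [hd xs])) = C"
    by (intro uniq vwalk_cycle_in_cycle_edge_sets) (auto simp: E_def)
  moreover have "{x, y} \<in> C" using p(3) xy by force
  ultimately have "{x, y} \<in> (\<lambda>(u, v). {u, v}) ` set (vwalk_arcs (xs @ [hd xs]))" by simp
  then obtain u v where "(u, v) \<in> E" "{x, y} = {u, v}" using xs(3) by auto
  then show False by (auto simp: E_def doubleton_eq_iff)
qed

end

section \<open>Breadth-first search and geodesics\<close>

lemma pcas_nth_eq:
  assumes "pcas u p v" "j < length p"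
  shows "p ! j = (pawalk_verts u p ! j, pawalk_verts u p ! Suc j)"
  using assms
proof (induction p arbitrary: u j)
  case (Cons e p)
  show ?case
  proof (cases j)
    case 0
    then show ?thesis using Cons.prems(1) by (cases p) (auto simp: prod_eq_iff)
  next
    case (Suc i)
    then show ?thesis using Cons.prems Cons.IH[of "snd e" i] by auto
  qed
qed simp

context pair_graph begin

text \<open>\<open>x\<close> is a vertex of the cycle where \<open>f\<close> is largest; its two
  neighbours on the cycle differ because the length is at least 3.\<close>

lemma cycle_local_max:
  fixes f :: "'a \<Rightarrow> nat"
  assumes "cycle p" "3 \<le> length p"
  obtains x y z where "(x, y) \<in> parcs G" "(x, z) \<in> parcs G" "y \<noteq> z" "f y \<le> f x" "f z \<le> f x"
proof -
  obtain u where u: "awalk u p u" "distinct (tl (pawalk_verts u p))"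
    using assms(1) unfolding cycle_def by auto
  define k where "k = length p"
  define a where "a j = pawalk_verts u p ! j" for j
  have cas: "pcas u p u" and sub: "set p \<subseteq> parcs G" using u(1) by (auto simp: awalk_def)
  have len: "length (pawalk_verts u p) = Suc k" using length_awalk_verts by (simp add: k_def)
  have arc: "(a j, a (Suc j)) \<in> parcs G" if "j < k" for j
    using pcas_nth_eq[OF cas, of j] that sub nth_mem[of j p] by (auto simp: a_def k_def)
  have inj: "a i \<noteq> a j" if "1 \<le> i" "i \<le> k" "1 \<le> j" "j \<le> k" "i \<noteq> j" for i j
    using u(2) that len nth_eq_iff_index_eq[of "tl (pawalk_verts u p)" "i - 1" "j - 1"]
    by (auto simp: a_def nth_tl)
  have "hd (pawalk_verts u p) = u" "last (pawalk_verts u p) = u"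
    using awhd_if_cas[OF cas] awlast_if_cas[OF cas] by auto
  then have closed: "a 0 = a k" using len by (simp add: a_def hd_conv_nth last_conv_nth)
  have k: "3 \<le> k" using assms(2) by (simp add: k_def)
  have "\<exists>j. j \<in> {1..k} \<and> (\<forall>i\<in>{1..k}. f (a i) \<le> f (a j))"
  proof -
    have "Max ((\<lambda>j. f (a j)) ` {1..k}) \<in> (\<lambda>j. f (a j)) ` {1..k}" using k by (intro Max_in) auto
    then obtain j where "j \<in> {1..k}" "f (a j) = Max ((\<lambda>j. f (a j)) ` {1..k})" by auto
    then show ?thesis by (intro exI[of _ j]) auto
  qed
  then obtain j where j: "1 \<le> j" "j \<le> k" and max: "\<And>i. 1 \<le> i \<Longrightarrow> i \<le> k \<Longrightarrow> f (a i) \<le> f (a j)"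
    by auto
  \<comment> \<open>Indices run over \<open>1..k\<close>, since \<open>a 0 = a k\<close>;
    \<open>s\<close> and \<open>r\<close> are the cyclic successor and predecessor of
    \<open>j\<close>.\<close>
  define s where "s = (if j = k then 1 else Suc j)"
  define r where "r = (if j = 1 then k else j - 1)"
  have "(a j, a s) \<in> parcs G" using arc[of j] arc[of 0] closed j k by (auto simp: s_def)
  moreover have "(a r, a j) \<in> parcs G" using arc[of "j - 1"] arc[of 0] closed j by (auto simp: r_def)
  then have "(a j, a r) \<in> parcs G" by (rule arcs_symmetric)
  moreover have "a s \<noteq> a r" using j k by (intro inj) (auto simp: s_def r_def)
  moreover have "f (a s) \<le> f (a j)" "f (a r) \<le> f (a j)"
    using j k max[of s] max[of r] by (auto simp: s_def r_def split: if_splits)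
  ultimately show ?thesis by (rule that)
qed

text \<open>
  The arcs of a breadth-first search tree, in both directions, number \<open>2 (n - 1)\<close>.  If there were no
  further arcs, a vertex of a cycle at maximal depth would have two distinct parents.
\<close>

lemma card_arcs_ge_if_cycle:
  assumes r: "r \<in> pverts G" and reach: "\<And>x. x \<in> pverts G \<Longrightarrow> \<exists>k. (r, x) \<in> parcs G ^^ k"
    and cyc: "cycle p" "3 \<le> length p"
  shows "2 * card (pverts G) \<le> card (parcs G)"
proof -
  define f where "f x = (LEAST k. (r, x) \<in> parcs G ^^ k)" for x
  \<comment> \<open>\<open>f\<close> is the distance from the root; the last vertex before
    \<open>x\<close> on a shortest walk is a parent of \<open>x\<close>, one level up.\<close>
  have "\<exists>y. (x, y) \<in> parcs G \<and> f x = Suc (f y)" if "x \<in> pverts G - {r}" for x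
  proof -
    have x: "(r, x) \<in> parcs G ^^ f x"
      unfolding f_def using reach[of x] that by (auto intro: LeastI_ex)
    moreover have "f x \<noteq> 0" using x that by (cases "f x") auto
    ultimately obtain j y where j: "f x = Suc j" "(r, y) \<in> parcs G ^^ j" "(y, x) \<in> parcs G"
      by (cases "f x") auto
    have y: "(r, y) \<in> parcs G ^^ f y" unfolding f_def using j(2) by (rule LeastI)
    have "f y \<le> j" unfolding f_def using j(2) by (rule Least_le)
    moreover have "(r, x) \<in> parcs G ^^ Suc (f y)" using y j(3) by auto
    then have "f x \<le> Suc (f y)" unfolding f_def[of x] by (rule Least_le)
    ultimately show ?thesis using j arcs_symmetric by auto
  qed
  then obtain q where q: "\<And>x. x \<in> pverts G - {r} \<Longrightarrow> (x, q x) \<in> parcs G \<and> f x = Suc (f (q x))"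
    by metis
  define T where "T = (\<lambda>x. (x, q x)) ` (pverts G - {r})"
  have T: "T \<subseteq> parcs G" "T\<inverse> \<subseteq> parcs G" using q arcs_symmetric by (auto simp: T_def)
  have Tf: "f y = Suc (f z)" "z = q y" if "(y, z) \<in> T" for y z using that q by (auto simp: T_def)
  have disj: "T \<inter> T\<inverse> = {}"
  proof (rule equals0I)
    fix e assume "e \<in> T \<inter> T\<inverse>"
    then obtain y z where "(y, z) \<in> T" "(z, y) \<in> T" by auto
    then show False using Tf(1)[of y z] Tf(1)[of z y] by simp
  qed
  have "card T = card (pverts G) - 1"
    unfolding T_def using r pair_finite_verts by (subst card_image) (auto intro: inj_onI)
  then have cT: "card (T \<union> T\<inverse>) = 2 * (card (pverts G) - 1)"
    using disj finite_subset[OF T(1) pair_finite_arcs] by (simp add: card_Un_disjoint)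
  obtain x y z where xyz: "(x, y) \<in> parcs G" "(x, z) \<in> parcs G" "y \<noteq> z" "f y \<le> f x" "f z \<le> f x"
    using cycle_local_max[OF cyc] by blast
  \<comment> \<open>A tree arc from \<open>x\<close> that does not go deeper leads to the parent of
    \<open>x\<close>. Hence one of the arcs to the distinct vertices \<open>y\<close> and
    \<open>z\<close> is outside the tree.\<close>
  have up: "y = q x" if "(x, y) \<in> T \<union> T\<inverse>" "f y \<le> f x" for y
    using that Tf(2)[of x y] Tf(1)[of y x] by auto
  have "\<exists>y. (x, y) \<in> parcs G \<and> (x, y) \<notin> T \<union> T\<inverse>" using xyz up by blast
  then obtain y where y: "(x, y) \<in> parcs G" "(x, y) \<notin> T \<union> T\<inverse>" by blast
  have "card ((T \<union> T\<inverse>) \<union> {(x, y), (y, x)}) = card (T \<union> T\<inverse>) + card {(x, y), (y, x)}"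
    using y finite_subset[OF T(1) pair_finite_arcs] by (intro card_Un_disjoint) auto
  moreover have "card {(x, y), (y, x)} = 2" using no_loops'[OF y(1)] by auto
  moreover have "card ((T \<union> T\<inverse>) \<union> {(x, y), (y, x)}) \<le> card (parcs G)"
    using T y arcs_symmetric by (intro card_mono pair_finite_arcs) auto
  moreover have "card (pverts G) > 0" using r pair_finite_verts by (auto simp: card_gt_0_iff)
  ultimately show ?thesis using cT by linarith
qed

section \<open>Walks as powers of the arc relation; distance and diameter\<close>

lemma awalk_relpow: "awalk u p v \<Longrightarrow> (u, v) \<in> parcs G ^^ length p"
proof (induction p arbitrary: u)
  case (Cons e p)
  then have "(fst e, snd e) \<in> parcs G" "u = fst e" "(snd e, v) \<in> parcs G ^^ length p"
    by (auto simp: awalk_Cons_iff)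
  then show ?case using relpow_Suc_I2[of "fst e" "snd e" "parcs G" v "length p"] by simp
qed (simp add: awalk_Nil_iff)

lemma relpow_awalk:
  "(u, v) \<in> parcs G ^^ k \<Longrightarrow> u \<in> pverts G \<Longrightarrow> \<exists>p. awalk u p v \<and> length p = k"
proof (induction k arbitrary: u)
  case (Suc k)
  obtain w where w: "(u, w) \<in> parcs G" "(w, v) \<in> parcs G ^^ k"
    using relpow_Suc_D2[OF Suc.prems(1)] by blast
  obtain p where "awalk w p v" "length p = k" using Suc.IH[OF w(2) in_arcsD2[OF w(1)]] by blast
  then show ?case using w(1) by (intro exI[of _ "(u, w) # p"]) (auto simp: awalk_Cons_iff)
qed (simp add: awalk_Nil_iff)

lemma connected_relpow:
  assumes "Digraph_Component.connected (with_proj G)" "u \<in> pverts G" "v \<in> pverts G"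
  shows "\<exists>k. (u, v) \<in> parcs G ^^ k"
proof -
  have "strongly_connected (with_proj G)"
    using symmetric_connected_imp_strongly_connected assms(1) sym_arcs by blast
  then have "u \<rightarrow>\<^sup>*\<^bsub>with_proj G\<^esub> v" using assms by (auto simp: strongly_connected_def)
  then show ?thesis using awalk_relpow by (auto simp: reachable_awalk)
qed

text \<open>The infimum defining \<open>\<mu>\<close> is attained by a shortest walk, which turns
  the extended real distance into a natural number.\<close>

lemma distance_eq_Least:
  assumes "u \<in> pverts G" "\<exists>k. (u, v) \<in> parcs G ^^ k"
  shows "distance G u v = ereal (real (LEAST k. (u, v) \<in> parcs G ^^ k))"
proof -
  have cost: "awalk_cost (\<lambda>_. 1) p = real (length p)" for p :: "('a \<times> 'a) list"
    by (induction p) (auto simp: awalk_cost_def)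
  obtain p where p: "awalk u p v" "length p = (LEAST k. (u, v) \<in> parcs G ^^ k)"
    using relpow_awalk[OF LeastI_ex[OF assms(2)] assms(1)] by blast
  show ?thesis unfolding distance_def \<mu>_def cost
  proof (rule antisym)
    show "(INF p\<in>{p. awalk u p v}. ereal (real (length p)))
        \<le> ereal (real (LEAST k. (u, v) \<in> parcs G ^^ k))"
      using p by (intro INF_lower2[of p]) auto
    show "ereal (real (LEAST k. (u, v) \<in> parcs G ^^ k))
        \<le> (INF p\<in>{p. awalk u p v}. ereal (real (length p)))"
      using awalk_relpow by (intro INF_greatest) (auto intro: Least_le)
  qed
qed

lemma diameter_attained:
  assumes "pverts G \<noteq> {}"
  obtains u v where "u \<in> pverts G" "v \<in> pverts G" "diameter G = distance G u v"
proof -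
  have att: "\<exists>x\<in>pverts G. (SUP x\<in>pverts G. h x) = h x" for h :: "'a \<Rightarrow> ereal"
    using Max_in[of "h ` pverts G"] Max_Sup[of "h ` pverts G"] assms pair_finite_verts by auto
  obtain u where u: "u \<in> pverts G" "diameter G = (SUP v\<in>pverts G. distance G u v)"
    using att unfolding diameter_def by blast
  then show ?thesis using att[of "distance G u"] that by auto
qed

text \<open>A shortcut between two vertices of a shortest walk would shorten the whole walk. The
  last conclusion is later used for \<open>c\<close> equal to 0, 1 and 2: the path is injective, it
  has no chords, and path vertices with a common neighbour are at most two steps apart.\<close>

lemma ex_geodesic:
  assumes con: "Digraph_Component.connected (with_proj G)" and diam: "diameter G = ereal (real d)"
  obtains P where "\<And>j. j \<le> d \<Longrightarrow> P j \<in> pverts G" "\<And>j. j < d \<Longrightarrow> (P j, P (Suc j)) \<in> parcs G"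
    "\<And>c i j. \<lbrakk>i \<le> d; j \<le> d; (P i, P j) \<in> parcs G ^^ c\<rbrakk> \<Longrightarrow> j \<le> i + c"
proof -
  have "pverts G \<noteq> {}" using con by (auto simp: connected_conv)
  then obtain u v where u: "u \<in> pverts G" "v \<in> pverts G" "diameter G = distance G u v"
    by (rule diameter_attained)
  define D where "D = (LEAST k. (u, v) \<in> parcs G ^^ k)"
  have ex: "\<exists>k. (u, v) \<in> parcs G ^^ k" using connected_relpow con u by blast
  then have "D = d" using distance_eq_Least[OF u(1) ex] diam u(3) by (simp add: D_def)
  then have d: "(u, v) \<in> parcs G ^^ d" using LeastI_ex[OF ex] by (simp add: D_def)
  have min: "d \<le> k" if "(u, v) \<in> parcs G ^^ k" for k
    using that \<open>D = d\<close> Least_le[of "\<lambda>k. (u, v) \<in> parcs G ^^ k" k] by (simp add: D_def)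
  obtain P where P: "P 0 = u" "P d = v" "\<And>j. j < d \<Longrightarrow> (P j, P (Suc j)) \<in> parcs G"
    using d by (auto simp: relpow_fun_conv)
  have steps: "(P i, P (i + k)) \<in> parcs G ^^ k" if "i + k \<le> d" for i k
    using that P(3) by (auto simp: relpow_fun_conv intro!: exI[of _ "\<lambda>j. P (i + j)"])
  have verts: "P j \<in> pverts G" if "j \<le> d" for j
    using that P u in_arcsD1[OF P(3), of j] by (cases "j = d") auto
  have "j \<le> i + c" if "i \<le> d" "j \<le> d" "(P i, P j) \<in> parcs G ^^ c" for c i j
  proof -
    have "(u, P i) \<in> parcs G ^^ i" using steps[of 0 i] that P by simp
    moreover have "(P j, v) \<in> parcs G ^^ (d - j)" using steps[of j "d - j"] that P by simp
    ultimately have "(u, v) \<in> parcs G ^^ (i + c + (d - j))"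
      using that(3) by (auto simp: relpow_add intro: relcompI)
    then show ?thesis using min[of "i + c + (d - j)"] that by linarith
  qed
  with verts P(3) show ?thesis by (intro that) auto
qed

end

section \<open>Degree sums\<close>

definition deg_cost :: "int \<Rightarrow> int" where
  "deg_cost k = (if k \<le> 1 then 3 else k * (k\<^sup>2 - 4))"

text \<open>This is \<open>k * (k - 2) * (k + 2)\<close> written in the excess
  \<open>k - 2\<close>.\<close>

lemma deg_cost_shift: "2 \<le> k \<Longrightarrow> deg_cost k = (k - 2) * ((k - 2)\<^sup>2 + 6 * (k - 2) + 8)"
  by (simp add: deg_cost_def power2_eq_square algebra_simps)

text \<open>\<open>X\<close> stands for the largest excess and \<open>Y\<close> for the sum of the
  others. For \<open>X + Y = m\<close> the gap to the bound is exactly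
  \<open>(3 * m + 12) * ((X - 1) * (Y - 1))\<close>; for a smaller sum it is at least 18.\<close>

lemma two_part_bound:
  fixes X Y m :: int
  assumes m: "2 \<le> m" and X: "0 \<le> X" "X \<le> m - 1" and Y: "0 \<le> Y" and XY: "X + Y \<le> m"
    and pos: "X = 0 \<Longrightarrow> Y = 0"
  defines "lhs \<equiv> 3 * (X + Y) + X * (X\<^sup>2 + 6 * X + 8) + Y * (Y\<^sup>2 + 6 * Y + 8)"
  shows "lhs \<le> m * (m + 1) * (m + 2) + 12"
    and "lhs = m * (m + 1) * (m + 2) + 12 \<Longrightarrow> X + Y = m \<and> (X - 1) * (Y - 1) = 0"
proof -
  define l where "l = X + Y"
  have lhs: "lhs = l * (l\<^sup>2 + 6 * l + 11) - (3 * l + 12) * (X * Y)"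
    unfolding lhs_def l_def by (simp add: power2_eq_square algebra_simps)
  have l0: "0 \<le> l" using X Y by (simp add: l_def)
  have "lhs \<le> m * (m + 1) * (m + 2) + 12 \<and>
    (lhs = m * (m + 1) * (m + 2) + 12 \<longrightarrow> X + Y = m \<and> (X - 1) * (Y - 1) = 0)"
  proof (cases "l = m")
    case True
    have gap: "lhs = m * (m + 1) * (m + 2) + 12 - (3 * m + 12) * ((X - 1) * (Y - 1))"
    proof -
      have "X * Y = (X - 1) * (Y - 1) + m - 1"
        using True by (simp add: l_def algebra_simps)
      then show ?thesis unfolding lhs True
        by (simp add: power2_eq_square algebra_simps)
    qed
    have "1 \<le> Y" using True X by (simp add: l_def)
    moreover have "1 \<le> X" using pos X \<open>1 \<le> Y\<close> by (cases "X = 0") auto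
    ultimately have "0 \<le> (X - 1) * (Y - 1)" by simp
    then have "0 \<le> (3 * m + 12) * ((X - 1) * (Y - 1))" using m by simp
    with gap m True show ?thesis by (auto simp: l_def)
  next
    case False
    then have lm: "l \<le> m - 1" using XY by (simp add: l_def)
    have "0 \<le> (3 * l + 12) * (X * Y)" using l0 X Y by simp
    then have "lhs \<le> l * (l\<^sup>2 + 6 * l + 11)" using lhs by simp
    also have "\<dots> \<le> (m - 1) * ((m - 1)\<^sup>2 + 6 * (m - 1) + 11)"
      using l0 lm m by (intro mult_mono add_mono power_mono) auto
    also have "\<dots> = m * (m + 1) * (m + 2) + 12 - 18"
      by (simp add: power2_eq_square algebra_simps)
    finally show ?thesis by simp
  qed
  then show "lhs \<le> m * (m + 1) * (m + 2) + 12"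
    and "lhs = m * (m + 1) * (m + 2) + 12 \<Longrightarrow> X + Y = m \<and> (X - 1) * (Y - 1) = 0" by auto
qed

text \<open>
  Writing \<open>x = t v - 2\<close>, the costs are \<open>x (x\<^sup>2 + 6 x + 8)\<close>, which is convex in \<open>x \<ge> 0\<close>: the sum
  is largest when the total excess, which equals the number of ones, is split as \<open>(m - 1) + 1\<close>.
\<close>

lemma sum_deg_cost:
  fixes t :: "'a \<Rightarrow> int" and m :: int
  assumes fin: "finite V" and ne: "V \<noteq> {}" and m: "2 \<le> m"
    and t: "\<And>v. v \<in> V \<Longrightarrow> 1 \<le> t v" "\<And>v. v \<in> V \<Longrightarrow> t v \<le> m + 1"
    and total: "(\<Sum>v\<in>V. t v) = 2 * int (card V)"
    and ones: "int (card {v \<in> V. t v = 1}) \<le> m"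
  shows "(\<Sum>v\<in>V. deg_cost (t v)) \<le> m * (m + 1) * (m + 2) + 12"
    and "(\<Sum>v\<in>V. deg_cost (t v)) = m * (m + 1) * (m + 2) + 12 \<Longrightarrow>
      int (card {v \<in> V. t v = 1}) = m \<and>
      (\<exists>a\<in>V. \<exists>b\<in>V. a \<noteq> b \<and> t a = m + 1 \<and> t b = 3 \<and> (\<forall>v\<in>V - {a, b}. t v \<le> 2))"
proof -
  define L where "L = {v \<in> V. t v = 1}"
  define l where "l = int (card L)"
  have L: "finite L" "L \<subseteq> V" using fin by (auto simp: L_def)
  have big: "2 \<le> t v" if "v \<in> V - L" for v using that t(1)[of v] by (auto simp: L_def)
  have "(\<Sum>v\<in>V. t v - 2) = (\<Sum>v\<in>V - L. t v - 2) + (\<Sum>v\<in>L. t v - 2)"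
    using sum.subset_diff[OF L(2) fin] .
  moreover have "(\<Sum>v\<in>L. t v - 2) = - l" by (simp add: L_def l_def)
  moreover have "(\<Sum>v\<in>V. t v - 2) = 0" using total by (simp add: sum_subtractf)
  ultimately have excess: "(\<Sum>v\<in>V - L. t v - 2) = l" by simp
  have "V - L \<noteq> {}"
  proof
    assume "V - L = {}"
    then have "V = L" using L by auto
    then have "\<And>v. v \<in> V \<Longrightarrow> t v = 1" unfolding L_def by blast
    then have "(\<Sum>v\<in>V. t v) = int (card V)" by simp
    with total ne fin show False by simp
  qed
  then have "Max (t ` (V - L)) \<in> t ` (V - L)" using fin by (intro Max_in) auto
  then obtain a where a: "a \<in> V - L" "t a = Max (t ` (V - L))" by auto
  have amax: "t v \<le> t a" if "v \<in> V - L" for v using that fin by (simp add: a(2))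
  define S where "S = V - L - {a}"
  define X where "X = t a - 2"
  define Y where "Y = l - X"
  have S: "finite S" "S \<subseteq> V - L" using fin by (auto simp: S_def)
  have sumS: "(\<Sum>v\<in>S. t v - 2) = Y"
    using sum.remove[OF _ a(1), of "\<lambda>v. t v - 2"] excess fin by (simp add: S_def X_def Y_def)
  have S0: "0 \<le> t v - 2" if "v \<in> S" for v using big S that by fastforce
  have SY: "t v - 2 \<le> Y" if "v \<in> S" for v
    using member_le_sum[OF that, of "\<lambda>v. t v - 2"] S0 S(1) sumS by simp
  have X: "0 \<le> X" "X \<le> m - 1" using big[OF a(1)] t(2)[of a] a(1) by (auto simp: X_def)
  have Y0: "0 \<le> Y" using sum_nonneg[of S "\<lambda>v. t v - 2"] S0 sumS by simp
  have XY: "X + Y = l" by (simp add: Y_def)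
  have pos: "Y = 0" if "X = 0"
  proof -
    have "t v - 2 = 0" if "v \<in> S" for v
      using S0[OF that] amax[of v] S that \<open>X = 0\<close> by (auto simp: X_def)
    then show ?thesis using sumS by simp
  qed
  \<comment> \<open>The cost of excess \<open>x\<close> is \<open>x * q x\<close> with
    \<open>q\<close> increasing, so replacing each \<open>q x\<close> over \<open>S\<close> by
    \<open>q Y\<close> merges all excesses in \<open>S\<close> into one excess \<open>Y\<close>. The
    loss is a sum of nonnegative slacks.\<close>
  define q where "q y = y\<^sup>2 + 6 * y + 8" for y :: int
  have costS: "deg_cost (t v) = (t v - 2) * q (t v - 2)" if "v \<in> S" for v
    using deg_cost_shift[of "t v"] S0[OF that] by (simp add: q_def)
  have q_mono: "q x \<le> q y" if "0 \<le> x" "x \<le> y" for x y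
    unfolding q_def using that by (intro add_mono power_mono mult_left_mono) auto
  have q_inj: "x = y" if "q x = q y" "0 \<le> x" "0 \<le> y" for x y
  proof -
    have "(x - y) * (x + y + 6) = 0"
      using that(1) by (simp add: q_def power2_eq_square algebra_simps)
    with that(2,3) show ?thesis by auto
  qed
  have cost: "(\<Sum>v\<in>V. deg_cost (t v)) = 3 * l + X * q X + (\<Sum>v\<in>S. deg_cost (t v))"
  proof -
    have "(\<Sum>v\<in>V. deg_cost (t v)) = (\<Sum>v\<in>V - L. deg_cost (t v)) + (\<Sum>v\<in>L. deg_cost (t v))"
      using sum.subset_diff[OF L(2) fin] .
    moreover have "(\<Sum>v\<in>L. deg_cost (t v)) = 3 * l" by (simp add: L_def l_def deg_cost_def)
    moreover have "(\<Sum>v\<in>V - L. deg_cost (t v)) = deg_cost (t a) + (\<Sum>v\<in>S. deg_cost (t v))"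
      using sum.remove[OF _ a(1), of "\<lambda>v. deg_cost (t v)"] fin by (simp add: S_def)
    moreover have "deg_cost (t a) = X * q X"
      using deg_cost_shift[OF big[OF a(1)]] by (simp add: X_def q_def)
    ultimately show ?thesis by simp
  qed
  have slack: "0 \<le> (t v - 2) * (q Y - q (t v - 2))" if "v \<in> S" for v
    using S0[OF that] q_mono[OF S0[OF that] SY[OF that]] by simp
  have sum_slack: "(\<Sum>v\<in>S. (t v - 2) * (q Y - q (t v - 2))) = Y * q Y - (\<Sum>v\<in>S. deg_cost (t v))"
  proof -
    have "(\<Sum>v\<in>S. (t v - 2) * (q Y - q (t v - 2))) = (\<Sum>v\<in>S. (t v - 2) * q Y - deg_cost (t v))"
      by (intro sum.cong refl) (simp only: costS right_diff_distrib)
    also have "\<dots> = (\<Sum>v\<in>S. t v - 2) * q Y - (\<Sum>v\<in>S. deg_cost (t v))"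
      by (simp only: sum_subtractf[of "\<lambda>v. (t v - 2) * q Y"] sum_distrib_right)
    finally show ?thesis by (simp only: sumS)
  qed
  have slack0: "0 \<le> (\<Sum>v\<in>S. (t v - 2) * (q Y - q (t v - 2)))" by (intro sum_nonneg slack)
  have lm: "X + Y \<le> m" using ones by (simp add: XY l_def L_def)
  note bound = two_part_bound[OF m X Y0 lm pos]
  have le: "(\<Sum>v\<in>V. deg_cost (t v)) \<le> 3 * (X + Y) + X * (X\<^sup>2 + 6 * X + 8) + Y * (Y\<^sup>2 + 6 * Y + 8)"
    using cost sum_slack slack0 by (simp add: XY q_def)
  with bound(1) show "(\<Sum>v\<in>V. deg_cost (t v)) \<le> m * (m + 1) * (m + 2) + 12" by simp
  assume eq: "(\<Sum>v\<in>V. deg_cost (t v)) = m * (m + 1) * (m + 2) + 12"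
  then have "X + Y = m \<and> (X - 1) * (Y - 1) = 0" using bound(1) le by (intro bound(2)) auto
  then have Xm: "X + Y = m" and one: "X = 1 \<or> Y = 1" by auto
  have "(\<Sum>v\<in>S. (t v - 2) * (q Y - q (t v - 2))) = 0"
    using bound(1) eq cost sum_slack slack0 by (simp add: XY q_def)
  then have "\<forall>v\<in>S. (t v - 2) * (q Y - q (t v - 2)) = 0"
    using sum_nonneg_eq_0_iff[of S "\<lambda>v. (t v - 2) * (q Y - q (t v - 2))"] S(1) slack by blast
  \<comment> \<open>All slacks vanish, so \<open>Y\<close> is not split any further: one vertex of
    \<open>S\<close> carries all of it.\<close>
  then have two: "t v - 2 = 0 \<or> t v - 2 = Y" if "v \<in> S" for v
    using that q_inj[of Y "t v - 2"] S0[OF that] Y0 by force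
  have Y1: "1 \<le> Y" using Xm X by simp
  have "\<exists>b\<in>S. t b - 2 \<noteq> 0"
  proof (rule ccontr)
    assume "\<not> (\<exists>b\<in>S. t b - 2 \<noteq> 0)"
    then have "(\<Sum>v\<in>S. t v - 2) = 0" by simp
    with sumS Y1 show False by simp
  qed
  then obtain b where b: "b \<in> S" "t b - 2 = Y" using two by blast
  have rest: "(\<Sum>v\<in>S - {b}. t v - 2) = 0"
    using sum.remove[OF S(1) b(1), of "\<lambda>v. t v - 2"] sumS b(2) by simp
  then have rest: "\<forall>v\<in>S - {b}. t v - 2 = 0"
    using sum_nonneg_eq_0_iff[of "S - {b}" "\<lambda>v. t v - 2"] S(1) S0 by auto
  \<comment> \<open>The choice of \<open>a\<close> as a maximum decides which of the two parts
    equals 1.\<close>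
  have "Y \<le> X" using amax[of b] b S by (auto simp: X_def)
  with one Y1 have "Y = 1" by auto
  have "t v \<le> 2" if "v \<in> V - {a, b}" for v
  proof (cases "v \<in> L")
    case True then show ?thesis by (simp add: L_def)
  next
    case False
    with that rest show ?thesis by (auto simp: S_def)
  qed
  then have "\<exists>a\<in>V. \<exists>b\<in>V. a \<noteq> b \<and> t a = m + 1 \<and> t b = 3 \<and> (\<forall>v\<in>V - {a, b}. t v \<le> 2)"
    using a b S Xm \<open>Y = 1\<close> by (intro bexI[of _ a] bexI[of _ b]) (auto simp: S_def X_def)
  with Xm XY show "int (card {v \<in> V. t v = 1}) = m \<and>
      (\<exists>a\<in>V. \<exists>b\<in>V. a \<noteq> b \<and> t a = m + 1 \<and> t b = 3 \<and> (\<forall>v\<in>V - {a, b}. t v \<le> 2))"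
    by (simp add: l_def L_def)
qed

text \<open>
  \<open>edge_cost (d\<^sub>u) + edge_cost (d\<^sub>v)\<close> dominates \<open>\<bar>d\<^sub>u\<^sup>2 - d\<^sub>v\<^sup>2\<bar>\<close>, and a vertex of degree \<open>k\<close> collects it
  \<open>k\<close> times, which makes \<open>deg_cost k\<close>.
\<close>

definition edge_cost :: "int \<Rightarrow> int" where
  "edge_cost k = (if k \<le> 1 then 3 else k\<^sup>2 - 4)"

lemma mult_edge_cost: "1 \<le> k \<Longrightarrow> k * edge_cost k = deg_cost k"
  by (auto simp: edge_cost_def deg_cost_def)

lemma sq_ge_4: "2 \<le> k \<Longrightarrow> 4 \<le> k\<^sup>2" for k :: int
  using power_mono[of 2 k 2] by simp

lemma sq_ge_9: "3 \<le> k \<Longrightarrow> 9 \<le> k\<^sup>2" for k :: int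
  using power_mono[of 3 k 2] by simp

lemma abs_diff_sq_le:
  fixes a b :: int
  assumes "1 \<le> a" "1 \<le> b"
  shows "\<bar>a\<^sup>2 - b\<^sup>2\<bar> \<le> edge_cost a + edge_cost b"
  using assms sq_ge_4[of a] sq_ge_4[of b] by (auto simp: edge_cost_def abs_if)

lemma abs_diff_sq_less:
  fixes a b :: int
  assumes "3 \<le> a" "3 \<le> b"
  shows "\<bar>a\<^sup>2 - b\<^sup>2\<bar> < edge_cost a + edge_cost b"
  using assms sq_ge_9[of a] sq_ge_9[of b] by (auto simp: edge_cost_def abs_if)

text \<open>If the smaller number is 2, or it is 1 and the other is not, both sides agree. Excluded
  are two ones, where 0 stands against 6, and two numbers of size at least 3.\<close>

lemma abs_diff_sq_eq:
  fixes a b :: int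
  assumes "1 \<le> a" "1 \<le> b" "a \<le> 2 \<or> b \<le> 2" "a \<noteq> 1 \<or> b \<noteq> 1"
  shows "\<bar>a\<^sup>2 - b\<^sup>2\<bar> = edge_cost a + edge_cost b"
proof -
  have "a = 1 \<or> a = 2 \<or> 3 \<le> a" "b = 1 \<or> b = 2 \<or> 3 \<le> b" using assms by auto
  then show ?thesis
    using assms sq_ge_9[of a] sq_ge_9[of b] by (elim disjE) (auto simp: edge_cost_def)
qed

section \<open>Degree sums in a symmetric irreflexive relation\<close>

locale graph_rel =
  fixes V :: "'a set" and E :: "('a \<times> 'a) set"
  assumes finite_V: "finite V" and E_subset: "E \<subseteq> V \<times> V" and sym_E: "sym E"
    and irrefl_E: "irrefl E" and nonisolated: "\<And>x. x \<in> V \<Longrightarrow> E `` {x} \<noteq> {}"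
begin

abbreviation dg :: "'a \<Rightarrow> nat" where "dg x \<equiv> card (E `` {x})"

lemma finite_E: "finite E"
  using E_subset finite_V finite_subset by blast

lemma finite_nbrs: "finite (E `` A)"
  using finite_E by (rule finite_Image)

lemma adj_sym: "(x, y) \<in> E \<Longrightarrow> (y, x) \<in> E"
  using sym_E by (rule symD)

lemma adj_neq: "(x, y) \<in> E \<Longrightarrow> x \<noteq> y"
  using irrefl_E by (auto simp: irrefl_def)

lemma adj_in: "(x, y) \<in> E \<Longrightarrow> x \<in> V" "(x, y) \<in> E \<Longrightarrow> y \<in> V"
  using E_subset by auto

lemma dg_pos: "x \<in> V \<Longrightarrow> 1 \<le> dg x"
  using nonisolated finite_nbrs by (simp add: Suc_le_eq card_gt_0_iff)

lemma sum_arcs: "(\<Sum>(u, v)\<in>E. F u v) = (\<Sum>u\<in>V. \<Sum>v\<in>E `` {u}. F u v)"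
proof -
  have "E = (SIGMA u:V. E `` {u})" using E_subset by auto
  then show ?thesis by (subst sum.Sigma) (auto simp: finite_V finite_nbrs)
qed

lemma card_arcs_from: "U \<subseteq> V \<Longrightarrow> card {e \<in> E. fst e \<in> U} = (\<Sum>u\<in>U. dg u)"
proof -
  assume U: "U \<subseteq> V"
  have "{e \<in> E. fst e \<in> U} = (SIGMA u:U. E `` {u})" by auto
  then show ?thesis using finite_subset[OF U finite_V] finite_nbrs by (simp add: card_SigmaI)
qed

lemma handshake: "(\<Sum>u\<in>V. dg u) = card E"
proof -
  have "{e \<in> E. fst e \<in> V} = E" using E_subset by auto
  then show ?thesis using card_arcs_from[of V] by simp
qed

text \<open>A vertex of degree \<open>k\<close> is the tail of \<open>k\<close> arcs and receives
  \<open>k * edge_cost k\<close>; reversing the arcs gives the same total for heads, hence the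
  factor 2.\<close>

lemma sum_edge_cost:
  "(\<Sum>(u, v)\<in>E. edge_cost (int (dg u)) + edge_cost (int (dg v))) = 2 * (\<Sum>v\<in>V. deg_cost (int (dg v)))"
proof -
  let ?h = "\<lambda>x. edge_cost (int (dg x))"
  have "(\<Sum>(u, v)\<in>E. ?h u) = (\<Sum>v\<in>V. deg_cost (int (dg v)))"
    unfolding sum_arcs using dg_pos by (intro sum.cong refl) (simp add: mult_edge_cost)
  moreover have "(\<Sum>(u, v)\<in>E. ?h v) = (\<Sum>(u, v)\<in>E. ?h u)"
    using adj_sym
    by (intro sum.reindex_bij_witness[of _ prod.swap prod.swap]) auto
  moreover have "(\<Sum>(u, v)\<in>E. ?h u + ?h v) = (\<Sum>(u, v)\<in>E. ?h u) + (\<Sum>(u, v)\<in>E. ?h v)"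
    by (simp add: sum.distrib split_def)
  ultimately show ?thesis by simp
qed

text \<open>Four times \<open>SO1\<close>, since both orientations of an edge count and the factor
  1/2 is dropped. Being an integer, it can be compared with the integer costs.\<close>

definition irregularity :: int where
  "irregularity = (\<Sum>(u, v)\<in>E. \<bar>(int (dg u))\<^sup>2 - (int (dg v))\<^sup>2\<bar>)"

lemma arc_cost_le:
  "(u, v) \<in> E \<Longrightarrow> \<bar>(int (dg u))\<^sup>2 - (int (dg v))\<^sup>2\<bar> \<le> edge_cost (int (dg u)) + edge_cost (int (dg v))"
  using dg_pos[of u] dg_pos[of v] adj_in[of u v] by (intro abs_diff_sq_le) auto

lemma irregularity_le: "irregularity \<le> 2 * (\<Sum>v\<in>V. deg_cost (int (dg v)))"
  unfolding irregularity_def sum_edge_cost[symmetric]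
  by (intro sum_mono) (auto intro: arc_cost_le)

lemma irregularity_eq:
  assumes "\<And>u v. (u, v) \<in> E \<Longrightarrow> dg u \<le> 2 \<or> dg v \<le> 2"
    and "\<And>u v. (u, v) \<in> E \<Longrightarrow> dg u \<noteq> 1 \<or> dg v \<noteq> 1"
  shows "irregularity = 2 * (\<Sum>v\<in>V. deg_cost (int (dg v)))"
proof -
  have "\<bar>(int (dg u))\<^sup>2 - (int (dg v))\<^sup>2\<bar> = edge_cost (int (dg u)) + edge_cost (int (dg v))"
    if "(u, v) \<in> E" for u v
    using assms[OF that] dg_pos adj_in[OF that] by (intro abs_diff_sq_eq) auto
  then show ?thesis
    unfolding irregularity_def sum_edge_cost[symmetric] by (intro sum.cong) auto
qed

text \<open>A single arc between two vertices of degree at least 3 makes the summed estimate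
  strict.\<close>

lemma irregularity_eqD:
  assumes eq: "irregularity = 2 * (\<Sum>v\<in>V. deg_cost (int (dg v)))" and uv: "(u, v) \<in> E"
  shows "dg u \<le> 2 \<or> dg v \<le> 2"
proof (rule ccontr)
  assume "\<not> ?thesis"
  then have "\<bar>(int (dg u))\<^sup>2 - (int (dg v))\<^sup>2\<bar> < edge_cost (int (dg u)) + edge_cost (int (dg v))"
    by (intro abs_diff_sq_less) auto
  then have "irregularity < (\<Sum>(u, v)\<in>E. edge_cost (int (dg u)) + edge_cost (int (dg v)))"
    unfolding irregularity_def using uv arc_cost_le
    by (intro sum_strict_mono_ex1 finite_E) (auto intro!: bexI[of _ "(u, v)"])
  then show False using eq sum_edge_cost by simp
qed

end

section \<open>Graphs with as many edges as vertices and a geodesic path\<close>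

locale geodesic_graph = graph_rel +
  fixes P :: "nat \<Rightarrow> 'a" and d m :: nat
  assumes P_in: "\<And>j. j \<le> d \<Longrightarrow> P j \<in> V"
    and P_step: "\<And>j. j < d \<Longrightarrow> (P j, P (Suc j)) \<in> E"
    and P_inj: "\<And>i j. \<lbrakk>i \<le> d; j \<le> d; P i = P j\<rbrakk> \<Longrightarrow> i = j"
    and P_near: "\<And>i j. \<lbrakk>i \<le> d; j \<le> d; (P i, P j) \<in> E\<rbrakk> \<Longrightarrow> j \<le> Suc i"
    and P_common: "\<And>i j x. \<lbrakk>i \<le> d; j \<le> d; (P i, x) \<in> E; (x, P j) \<in> E\<rbrakk> \<Longrightarrow> j \<le> i + 2"
    and card_V: "card V = d + m" and card_E: "card E = 2 * card V"
    and d_ge: "4 \<le> d" and m_ge: "2 \<le> m"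
begin

definition W :: "'a set" where "W = V - P ` {..d}"

lemma P_inj_on: "inj_on P {..d}"
  using P_inj by (auto intro: inj_onI)

lemma P_image: "P ` {..d} \<subseteq> V"
  using P_in by auto

lemma finite_W: "finite W"
  using finite_V by (simp add: W_def)

lemma card_W: "card W = m - 1"
  unfolding W_def using P_image P_inj_on card_V by (simp add: card_Diff_subset card_image)

lemma adj_P: "\<lbrakk>i \<le> d; j \<le> d; (P i, P j) \<in> E\<rbrakk> \<Longrightarrow> j = Suc i \<or> i = Suc j"
  using P_near[of i j] P_near[of j i] adj_sym[of "P i" "P j"] adj_neq[of "P i" "P j"]
  by (cases "i = j") auto

text \<open>At the ends, \<open>P (j - 1)\<close> is \<open>P 0\<close> itself and
  \<open>P (Suc d)\<close> is an arbitrary value; this is harmless in an upper bound.\<close>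

lemma nbrs_P: "j \<le> d \<Longrightarrow> E `` {P j} \<subseteq> {P (j - 1), P (Suc j)} \<union> W"
proof
  fix x assume j: "j \<le> d" and x: "x \<in> E `` {P j}"
  show "x \<in> {P (j - 1), P (Suc j)} \<union> W"
  proof (cases "x \<in> P ` {..d}")
    case True
    then obtain i where "i \<le> d" "x = P i" by auto
    then show ?thesis using adj_P[of j i] j x by auto
  next
    case False
    then show ?thesis using x adj_in by (auto simp: W_def)
  qed
qed

text \<open>By \<open>P_common\<close>, the indices of the path neighbours lie within two of the
  least one.\<close>

lemma card_path_nbrs: "x \<in> V \<Longrightarrow> card (E `` {x} \<inter> P ` {..d}) \<le> 3"
proof (cases "E `` {x} \<inter> P ` {..d} = {}")
  case False
  define J where "J = {j. j \<le> d \<and> (x, P j) \<in> E}"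
  define k where "k = (LEAST j. j \<in> J)"
  have ex: "\<exists>j. j \<in> J" using False by (auto simp: J_def)
  have k: "k \<in> J" unfolding k_def using ex by (rule LeastI_ex)
  have "J \<subseteq> {k..k + 2}"
    using k Least_le[of "\<lambda>j. j \<in> J"] P_common[of k _ x] adj_sym by (auto simp: J_def k_def)
  then have "card J \<le> 3" using card_mono[of "{k..k + 2}" J] by simp
  moreover have "E `` {x} \<inter> P ` {..d} = P ` J" by (auto simp: J_def)
  moreover have "finite J" by (simp add: J_def)
  ultimately show ?thesis using card_image_le[of J P] by simp
qed simp

text \<open>A vertex of \<open>W\<close> has at most 3 neighbours on the path and
  \<open>m - 2\<close> off it; a path vertex has at most 2 on the path and \<open>m - 1\<close> off
  it.\<close>

lemma dg_le: "x \<in> V \<Longrightarrow> dg x \<le> m + 1"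
proof (cases "x \<in> W")
  case True
  assume x: "x \<in> V"
  have "E `` {x} \<subseteq> (E `` {x} \<inter> P ` {..d}) \<union> (W - {x})"
    using adj_in(2)[of x] adj_neq[of x] by (auto simp: W_def)
  then have "dg x \<le> card ((E `` {x} \<inter> P ` {..d}) \<union> (W - {x}))"
    using finite_nbrs finite_W by (intro card_mono) auto
  also have "\<dots> \<le> card (E `` {x} \<inter> P ` {..d}) + card (W - {x})" by (rule card_Un_le)
  also have "\<dots> \<le> 3 + (m - 2)"
    using card_path_nbrs[OF x] True card_W finite_W by (intro add_mono) auto
  finally show ?thesis using m_ge by simp
next
  case False
  assume "x \<in> V"
  with False obtain j where j: "j \<le> d" "x = P j" by (auto simp: W_def)
  have "dg x \<le> card ({P (j - 1), P (Suc j)} \<union> W)"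
    using nbrs_P[OF j(1)] finite_W j(2) by (intro card_mono) auto
  also have "\<dots> \<le> card {P (j - 1), P (Suc j)} + card W" by (rule card_Un_le)
  also have "\<dots> \<le> 2 + (m - 1)"
    using card_length[of "[P (j - 1), P (Suc j)]"] card_W by simp
  finally show ?thesis using m_ge by simp
qed

lemma path_arcs_count: "card {e \<in> E. fst e \<in> P ` {..d} \<and> snd e \<in> P ` {..d}} \<le> 2 * d"
proof -
  let ?A = "(\<lambda>j. (P j, P (Suc j))) ` {..<d}" and ?B = "(\<lambda>j. (P (Suc j), P j)) ` {..<d}"
  have "{e \<in> E. fst e \<in> P ` {..d} \<and> snd e \<in> P ` {..d}} \<subseteq> ?A \<union> ?B"
    using adj_P by (fastforce simp: image_iff)
  then have "card {e \<in> E. fst e \<in> P ` {..d} \<and> snd e \<in> P ` {..d}} \<le> card (?A \<union> ?B)"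
    by (intro card_mono) auto
  also have "\<dots> \<le> card ?A + card ?B" by (rule card_Un_le)
  also have "\<dots> \<le> d + d"
    using card_image_le[of "{..<d}" "\<lambda>j. (P j, P (Suc j))"]
      card_image_le[of "{..<d}" "\<lambda>j. (P (Suc j), P j)"] by (intro add_mono) auto
  finally show ?thesis by simp
qed

text \<open>There are \<open>m\<close> edges off the path; each of them ends in \<open>W - {w}\<close> or joins \<open>w\<close> to the path.\<close>

lemma off_path_edges:
  assumes w: "w \<in> W"
  shows "m \<le> (\<Sum>x\<in>W - {w}. dg x) + card (E `` {w} \<inter> P ` {..d})"
proof -
  define Q where "Q = {e \<in> E. fst e \<in> P ` {..d} \<and> snd e \<in> P ` {..d}}"
  define A where "A = {e \<in> E. fst e \<in> W - {w}}"
  define B where "B = Pair w ` (E `` {w} \<inter> P ` {..d})"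
  have fin: "finite Q" "finite A" "finite B" using finite_E finite_nbrs by (auto simp: Q_def A_def B_def)
  have "E \<subseteq> Q \<union> ((A \<union> A\<inverse>) \<union> (B \<union> B\<inverse>))"
  proof
    fix e assume "e \<in> E"
    moreover obtain x y where e: "e = (x, y)" by fastforce
    ultimately have xy: "(x, y) \<in> E" "(y, x) \<in> E" "x \<in> V" "y \<in> V" "x \<noteq> y"
      using adj_sym adj_in adj_neq by auto
    have "x \<in> P ` {..d} \<or> x = w \<or> x \<in> W - {w}" "y \<in> P ` {..d} \<or> y = w \<or> y \<in> W - {w}"
      using xy by (auto simp: W_def)
    then show "e \<in> Q \<union> ((A \<union> A\<inverse>) \<union> (B \<union> B\<inverse>))"
      using xy unfolding e Q_def A_def B_def by fastforce
  qed
  then have "card E \<le> card (Q \<union> ((A \<union> A\<inverse>) \<union> (B \<union> B\<inverse>)))" using fin by (intro card_mono) auto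
  also have "\<dots> \<le> card Q + ((card A + card (A\<inverse>)) + (card B + card (B\<inverse>)))"
    by (intro order_trans[OF card_Un_le] add_mono card_Un_le order_refl)
  also have "\<dots> \<le> 2 * d + 2 * card A + 2 * card B"
    using path_arcs_count by (simp add: Q_def)
  also have "card A = (\<Sum>x\<in>W - {w}. dg x)"
    unfolding A_def by (intro card_arcs_from) (auto simp: W_def)
  also have "card B = card (E `` {w} \<inter> P ` {..d})"
    unfolding B_def by (intro card_image inj_onI) auto
  finally show ?thesis using card_E card_V by simp
qed

lemma sum_dg_le_1:
  assumes "\<And>x. x \<in> W \<Longrightarrow> dg x \<le> 1" "w \<in> W"
  shows "(\<Sum>x\<in>W - {w}. dg x) \<le> m - 2"
proof -
  have "(\<Sum>x\<in>W - {w}. dg x) \<le> (\<Sum>x\<in>W - {w}. 1)" using assms by (intro sum_mono) auto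
  then show ?thesis using card_W assms(2) finite_W by simp
qed

text \<open>If \<open>W\<close> consisted of leaves, at most \<open>(m - 2) + 1\<close> edges could
  lie off the path, but there are \<open>m\<close>.\<close>

lemma ex_nonleaf: "\<exists>w\<in>W. 2 \<le> dg w"
proof (rule ccontr)
  assume "\<not> ?thesis"
  then have leaf: "dg x \<le> 1" if "x \<in> W" for x using that by force
  have "W \<noteq> {}" using card_W m_ge by auto
  then obtain w where w: "w \<in> W" by auto
  have "card (E `` {w} \<inter> P ` {..d}) \<le> dg w" using finite_nbrs by (intro card_mono) auto
  then show False using off_path_edges[OF w] sum_dg_le_1[OF leaf w] leaf[OF w] m_ge by linarith
qed

lemma interior_dg:
  assumes "0 < j" "j < d"
  shows "2 \<le> dg (P j)"
proof -
  have "{P (j - 1), P (Suc j)} \<subseteq> E `` {P j}"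
    using P_step[of "j - 1"] P_step[of j] assms adj_sym by auto
  moreover have "P (j - 1) \<noteq> P (Suc j)" using P_inj[of "j - 1" "Suc j"] assms by fastforce
  ultimately show ?thesis using card_mono[OF finite_nbrs, of "{P (j - 1), P (Suc j)}" "{P j}"] by simp
qed

text \<open>Interior path vertices and \<open>w\<close> are no leaves. The superset has exactly
  \<open>m\<close> elements, so in the case of equality it is the set of leaves.\<close>

lemma leaves_subset:
  assumes w: "w \<in> W" "2 \<le> dg w"
  shows "{x \<in> V. dg x = 1} \<subseteq> {P 0, P d} \<union> (W - {w})"
proof
  fix x assume x: "x \<in> {x \<in> V. dg x = 1}"
  show "x \<in> {P 0, P d} \<union> (W - {w})"
  proof (cases "x \<in> W")
    case True
    then show ?thesis using x w by auto
  next
    case False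
    then obtain j where "j \<le> d" "x = P j" using x by (auto simp: W_def)
    then show ?thesis using x interior_dg[of j] by (cases "0 < j \<and> j < d") auto
  qed
qed

lemma card_leaf_superset:
  assumes w: "w \<in> W"
  shows "card ({P 0, P d} \<union> (W - {w})) = m"
proof -
  have "card ({P 0, P d} \<union> (W - {w})) = card {P 0, P d} + card (W - {w})"
    using finite_W by (intro card_Un_disjoint) (auto simp: W_def)
  moreover have "P 0 \<noteq> P d" using P_inj[of 0 d] d_ge by auto
  ultimately show ?thesis using card_W w finite_W m_ge by simp
qed

lemma card_leaves: "card {x \<in> V. dg x = 1} \<le> m"
proof -
  obtain w where w: "w \<in> W" "2 \<le> dg w" using ex_nonleaf by blast
  then show ?thesis
    using card_mono[OF _ leaves_subset[OF w]] card_leaf_superset[OF w(1)] finite_W by simp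
qed

definition extremal_value :: int where
  "extremal_value = int m * (int m + 1) * (int m + 2) + 12"

lemma deg_cost_bound:
  shows "(\<Sum>v\<in>V. deg_cost (int (dg v))) \<le> extremal_value"
    and "(\<Sum>v\<in>V. deg_cost (int (dg v))) = extremal_value \<Longrightarrow>
      card {v \<in> V. dg v = 1} = m \<and>
      (\<exists>a\<in>V. \<exists>b\<in>V. a \<noteq> b \<and> dg a = m + 1 \<and> dg b = 3 \<and> (\<forall>v\<in>V - {a, b}. dg v \<le> 2))"
proof -
  let ?t = "\<lambda>v. int (dg v)"
  have ne: "V \<noteq> {}" using card_V m_ge by auto
  have m: "2 \<le> int m" using m_ge by simp
  have lo: "1 \<le> ?t v" if "v \<in> V" for v using dg_pos[OF that] by simp
  have hi: "?t v \<le> int m + 1" if "v \<in> V" for v using dg_le[OF that] by linarith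
  have "(\<Sum>v\<in>V. ?t v) = int (\<Sum>v\<in>V. dg v)" by simp
  then have total: "(\<Sum>v\<in>V. ?t v) = 2 * int (card V)" unfolding handshake card_E by simp
  have leaf: "{v \<in> V. ?t v = 1} = {v \<in> V. dg v = 1}" by auto
  have ones: "int (card {v \<in> V. ?t v = 1}) \<le> int m" unfolding leaf using card_leaves by simp
  note main = sum_deg_cost[of V "int m" ?t, OF finite_V ne m lo hi total ones]
  show "(\<Sum>v\<in>V. deg_cost (?t v)) \<le> extremal_value"
    using main(1) by (simp add: extremal_value_def)
  assume "(\<Sum>v\<in>V. deg_cost (?t v)) = extremal_value"
  then have *: "int (card {v \<in> V. dg v = 1}) = int m \<and>
      (\<exists>a\<in>V. \<exists>b\<in>V. a \<noteq> b \<and> ?t a = int m + 1 \<and> ?t b = 3 \<and> (\<forall>v\<in>V - {a, b}. ?t v \<le> 2))"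
    using main(2) unfolding leaf by (simp add: extremal_value_def)
  then obtain a b where "a \<in> V" "b \<in> V" "a \<noteq> b" "?t a = int m + 1" "?t b = 3"
      "\<forall>v\<in>V - {a, b}. ?t v \<le> 2" by blast
  then have "a \<in> V" "b \<in> V" "a \<noteq> b" "dg a = m + 1" "dg b = 3" "\<forall>v\<in>V - {a, b}. dg v \<le> 2" by auto
  with * show "card {v \<in> V. dg v = 1} = m \<and>
      (\<exists>a\<in>V. \<exists>b\<in>V. a \<noteq> b \<and> dg a = m + 1 \<and> dg b = 3 \<and> (\<forall>v\<in>V - {a, b}. dg v \<le> 2))"
    by (intro conjI bexI[of _ a] bexI[of _ b]) simp_all
qed

lemma irregularity_bound: "irregularity \<le> 2 * extremal_value"
  using irregularity_le deg_cost_bound(1) by linarith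

end

section \<open>The extremal graphs\<close>

lemma pverts_U_graph: "pverts (U_graph (d + m) d i) = PathV ` {0..d} \<union> PendV ` {1..m - 1}"
  by (simp add: U_graph_def add_edge_def T_graph_def Let_def)

lemma U_graph_arc_iff:
  "(PathV a, PathV b) \<in> parcs (U_graph (d + m) d i) \<longleftrightarrow> b = Suc a \<and> a < d \<or> a = Suc b \<and> b < d"
  "(PathV a, PendV k) \<in> parcs (U_graph (d + m) d i) \<longleftrightarrow>
    a = i \<and> 1 \<le> k \<and> k \<le> m - 1 \<or> a = i + 2 \<and> k = m - 1"
  "(PendV k, PathV a) \<in> parcs (U_graph (d + m) d i) \<longleftrightarrow>
    a = i \<and> 1 \<le> k \<and> k \<le> m - 1 \<or> a = i + 2 \<and> k = m - 1"
  "(PendV k, PendV l) \<notin> parcs (U_graph (d + m) d i)"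
  by (auto simp: U_graph_def add_edge_def T_graph_def Let_def)

text \<open>The bounds on \<open>i\<close> keep both attachment vertices in the interior of the
  path, which gives them degrees \<open>m + 1\<close> and 3.\<close>

locale U_graph_params =
  fixes d m i :: nat
  assumes m_ge: "2 \<le> m" and i_pos: "0 < i" and i_less: "i + 2 < d"
begin

abbreviation "VU \<equiv> pverts (U_graph (d + m) d i)"
abbreviation "EU \<equiv> parcs (U_graph (d + m) d i)"

lemma nbrs_PendV:
  "\<lbrakk>1 \<le> k; k < m - 1\<rbrakk> \<Longrightarrow> EU `` {PendV k} = {PathV i}"
  "EU `` {PendV (m - 1)} = {PathV i, PathV (i + 2)}"
  subgoal by (rule set_eqI, case_tac x) (auto simp: U_graph_arc_iff)
  subgoal using m_ge by (intro set_eqI, case_tac x) (auto simp: U_graph_arc_iff)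
  done

lemma nbrs_PathV:
  "EU `` {PathV 0} = {PathV 1}"
  "EU `` {PathV d} = {PathV (d - 1)}"
  "EU `` {PathV i} = {PathV (i - 1), PathV (i + 1)} \<union> PendV ` {1..m - 1}"
  "EU `` {PathV (i + 2)} = {PathV (i + 1), PathV (i + 3), PendV (m - 1)}"
  "\<lbrakk>0 < j; j < d; j \<noteq> i; j \<noteq> i + 2\<rbrakk> \<Longrightarrow> EU `` {PathV j} = {PathV (j - 1), PathV (j + 1)}"
  subgoal using i_pos i_less by (intro set_eqI, case_tac x) (auto simp: U_graph_arc_iff)
  subgoal using i_pos i_less by (intro set_eqI, case_tac x) (auto simp: U_graph_arc_iff)
  subgoal using i_pos i_less by (intro set_eqI, case_tac x) (auto simp: U_graph_arc_iff)
  subgoal using i_pos i_less m_ge by (intro set_eqI, case_tac x) (auto simp: U_graph_arc_iff)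
  subgoal by (intro set_eqI, case_tac x) (auto simp: U_graph_arc_iff)
  done

lemma deg_U_graph:
  "\<lbrakk>1 \<le> k; k < m - 1\<rbrakk> \<Longrightarrow> card (EU `` {PendV k}) = 1"
  "card (EU `` {PendV (m - 1)}) = 2"
  "card (EU `` {PathV 0}) = 1"
  "card (EU `` {PathV d}) = 1"
  "card (EU `` {PathV i}) = m + 1"
  "card (EU `` {PathV (i + 2)}) = 3"
  "\<lbrakk>0 < j; j < d; j \<noteq> i; j \<noteq> i + 2\<rbrakk> \<Longrightarrow> card (EU `` {PathV j}) = 2"
proof -
  have "card ({PathV (i - 1), PathV (i + 1)} \<union> PendV ` {1..m - 1})
      = card {PathV (i - 1), PathV (i + 1)} + card (PendV ` {1..m - 1})"
    by (intro card_Un_disjoint) auto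
  also have "card (PendV ` {1..m - 1}) = m - 1" by (subst card_image) (auto intro: inj_onI)
  finally show "card (EU `` {PathV i}) = m + 1" using m_ge by (simp add: nbrs_PathV)
  show "card (EU `` {PendV (m - 1)}) = 2" unfolding nbrs_PendV(2) by simp
  show "card (EU `` {PathV (i + 2)}) = 3" unfolding nbrs_PathV(4) by simp
qed (simp_all add: nbrs_PendV(1) nbrs_PathV)

text \<open>There are \<open>m\<close> leaves, one vertex of degree \<open>m + 1\<close> and another
  of degree 3; all others have degree 2 and drop out. With \<open>F k = k - 2\<close> this counts
  the arcs, with \<open>deg_cost\<close> it gives the irregularity.\<close>

lemma sum_deg_U_graph:
  fixes F :: "nat \<Rightarrow> int"
  assumes "F 2 = 0"
  shows "(\<Sum>v\<in>VU. F (card (EU `` {v}))) = int m * F 1 + F (m + 1) + F 3"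
proof -
  let ?f = "\<lambda>v. F (card (EU `` {v}))"
  have "(\<Sum>v\<in>VU. ?f v) = (\<Sum>v\<in>PathV ` {0..d}. ?f v) + (\<Sum>v\<in>PendV ` {1..m - 1}. ?f v)"
    unfolding pverts_U_graph by (intro sum.union_disjoint) auto
  also have "(\<Sum>v\<in>PathV ` {0..d}. ?f v) = (\<Sum>j\<in>{0..d}. ?f (PathV j))"
    by (subst sum.reindex) (auto intro: inj_onI)
  also have "\<dots> = (\<Sum>j\<in>{0, d, i, i + 2}. ?f (PathV j))"
    using i_pos i_less deg_U_graph(7) assms by (intro sum.mono_neutral_right) auto
  also have "\<dots> = 2 * F 1 + F (m + 1) + F 3"
    using i_pos i_less deg_U_graph(3-6) by simp
  also have "(\<Sum>v\<in>PendV ` {1..m - 1}. ?f v) = (\<Sum>k\<in>{1..m - 1}. ?f (PendV k))"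
    by (subst sum.reindex) (auto intro: inj_onI)
  also have "\<dots> = (\<Sum>k\<in>{1..<m - 1}. ?f (PendV k))"
  proof (intro sum.mono_neutral_right ballI)
    fix k assume "k \<in> {1..m - 1} - {1..<m - 1}"
    then have "k = m - 1" by auto
    then show "?f (PendV k) = 0" using deg_U_graph(2) assms by (simp only:)
  qed auto
  also have "\<dots> = int (m - 2) * F 1" using deg_U_graph(1) by (simp add: numeral_2_eq_2)
  finally show ?thesis using m_ge by (simp add: of_nat_diff algebra_simps)
qed

sublocale graph_rel VU EU
proof
  show "finite VU" by (simp add: pverts_U_graph)
  show "EU \<subseteq> VU \<times> VU"
  proof
    fix e assume "e \<in> EU"
    moreover obtain x y where "e = (x, y)" by fastforce
    ultimately show "e \<in> VU \<times> VU"
      using i_less m_ge by (cases x; cases y) (auto simp: U_graph_arc_iff pverts_U_graph)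
  qed
  show "sym EU"
  proof (rule symI)
    fix x y assume "(x, y) \<in> EU"
    then show "(y, x) \<in> EU" by (cases x; cases y) (auto simp: U_graph_arc_iff)
  qed
  have "(x, x) \<notin> EU" for x by (cases x) (auto simp: U_graph_arc_iff)
  then show "irrefl EU" by (simp add: irrefl_def)
  show "EU `` {x} \<noteq> {}" if x: "x \<in> VU" for x
  proof (cases x)
    case (PathV j)
    then have "(PathV j, PathV (if j = 0 then 1 else j - 1)) \<in> EU"
      using x i_less by (auto simp: U_graph_arc_iff pverts_U_graph)
    then show ?thesis using PathV by blast
  next
    case (PendV k)
    then have "(PendV k, PathV i) \<in> EU" using x by (auto simp: U_graph_arc_iff pverts_U_graph)
    then show ?thesis using PendV by blast
  qed
qed

lemma card_EU: "card EU = 2 * (d + m)"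
proof -
  have "(\<Sum>v\<in>VU. int (dg v) - 2) = 0" using sum_deg_U_graph[of "\<lambda>k. int k - 2"] by simp
  then have "int (\<Sum>v\<in>VU. dg v) = 2 * int (card VU)" by (simp add: sum_subtractf)
  moreover have "card VU = card (PathV ` {0..d}) + card (PendV ` {1..m - 1})"
    unfolding pverts_U_graph by (intro card_Un_disjoint) auto
  moreover have "card (PathV ` {0..d}) = d + 1" by (subst card_image) (auto intro: inj_onI)
  moreover have "card (PendV ` {1..m - 1}) = m - 1" by (subst card_image) (auto intro: inj_onI)
  ultimately have "int (card EU) = int (2 * (d + 1 + (m - 1)))" by (simp add: handshake)
  then have "card EU = 2 * (d + 1 + (m - 1))" by (simp only: of_nat_eq_iff)
  then show ?thesis using m_ge by simp
qed

lemma dg_cases: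
  assumes "v \<in> VU"
  shows "v = PathV i \<or> v = PathV (i + 2) \<or> dg v = 2 \<or>
    dg v = 1 \<and> v \<in> {PathV 0, PathV d} \<union> PendV ` {1..<m - 1}"
proof (cases v)
  case (PathV j)
  then have "j \<le> d" using assms by (auto simp: pverts_U_graph)
  then show ?thesis using PathV deg_U_graph(3,4) deg_U_graph(7)[of j] by (cases "j = 0 \<or> j = d \<or> j = i \<or> j = i + 2") auto
next
  case (PendV k)
  then have k: "1 \<le> k" "k \<le> m - 1" using assms by (auto simp: pverts_U_graph)
  then show ?thesis using PendV deg_U_graph(1)[of k] deg_U_graph(2) by (cases "k = m - 1") auto
qed

text \<open>The edge estimate is sharp on every arc: the two vertices of large degree are two steps
  apart, and no two leaves are adjacent.\<close>

lemma irregularity_U: "irregularity = 2 * (int m * (int m + 1) * (int m + 2) + 12)"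
proof -
  have "irregularity = 2 * (\<Sum>v\<in>VU. deg_cost (int (dg v)))"
  proof (rule irregularity_eq)
    fix u v assume uv: "(u, v) \<in> EU"
    note V = adj_in(1)[OF uv] adj_in(2)[OF uv]
    show "dg u \<le> 2 \<or> dg v \<le> 2"
    proof (rule ccontr)
      assume "\<not> ?thesis"
      then have "u \<in> {PathV i, PathV (i + 2)}" "v \<in> {PathV i, PathV (i + 2)}"
        using dg_cases[OF V(1)] dg_cases[OF V(2)] by auto
      then show False using uv by (auto simp: U_graph_arc_iff)
    qed
    show "dg u \<noteq> 1 \<or> dg v \<noteq> 1"
    proof (rule ccontr)
      assume leaf: "\<not> ?thesis"
      have "u \<in> {PathV 0, PathV d} \<union> PendV ` {1..<m - 1}"
        using leaf dg_cases[OF V(1)] deg_U_graph(5,6) m_ge by auto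
      moreover have "v \<in> {PathV 0, PathV d} \<union> PendV ` {1..<m - 1}"
        using leaf dg_cases[OF V(2)] deg_U_graph(5,6) m_ge by auto
      ultimately show False using uv i_pos i_less by (auto simp: U_graph_arc_iff)
    qed
  qed
  also have "(\<Sum>v\<in>VU. deg_cost (int (dg v))) = int m * (int m + 1) * (int m + 2) + 12"
    using sum_deg_U_graph[of "\<lambda>k. deg_cost (int k)"] m_ge
    by (simp add: deg_cost_def power2_eq_square algebra_simps)
  finally show ?thesis .
qed

end

section \<open>The case of equality\<close>

context geodesic_graph begin

text \<open>Allows the vertex of degree \<open>m + 1\<close> to be taken as the one with the smaller
  index.\<close>

lemma reversed: "geodesic_graph V E (\<lambda>j. P (d - j)) d m"
proof unfold_locales
  show "j \<le> d \<Longrightarrow> P (d - j) \<in> V" for j using P_in by simp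
  show "j < d \<Longrightarrow> (P (d - j), P (d - Suc j)) \<in> E" for j
    using P_step[of "d - Suc j"] adj_sym by (simp add: Suc_diff_Suc)
  show "\<lbrakk>i \<le> d; j \<le> d; P (d - i) = P (d - j)\<rbrakk> \<Longrightarrow> i = j" for i j
    using P_inj[of "d - i" "d - j"] by simp
  show "\<lbrakk>i \<le> d; j \<le> d; (P (d - i), P (d - j)) \<in> E\<rbrakk> \<Longrightarrow> j \<le> Suc i" for i j
    using P_near[of "d - j" "d - i"] adj_sym by fastforce
  show "\<lbrakk>i \<le> d; j \<le> d; (P (d - i), x) \<in> E; (x, P (d - j)) \<in> E\<rbrakk> \<Longrightarrow> j \<le> i + 2" for i j x
    using P_common[of "d - j" "d - i" x] adj_sym by fastforce
qed (use card_V card_E d_ge m_ge in auto)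

lemma extremal_structure:
  assumes eq: "irregularity = 2 * extremal_value"
  obtains i j w where "0 < i" "i < d" "0 < j" "j < d" "j = i + 2 \<or> i = j + 2" "dg (P i) = m + 1"
    "w \<in> W" "(w, P i) \<in> E" "(w, P j) \<in> E"
proof -
  have cost: "(\<Sum>v\<in>V. deg_cost (int (dg v))) = extremal_value"
    using eq irregularity_le deg_cost_bound(1) by linarith
  then obtain a b where leaves: "card {v \<in> V. dg v = 1} = m"
      and ab: "a \<in> V" "b \<in> V" "a \<noteq> b" "dg a = m + 1" "dg b = 3" "\<And>v. v \<in> V - {a, b} \<Longrightarrow> dg v \<le> 2"
    using deg_cost_bound(2) by blast
  have "(a, b) \<notin> E" using irregularity_eqD[of a b] eq cost ab m_ge by auto
  obtain w where w: "w \<in> W" "2 \<le> dg w" using ex_nonleaf by blast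
  have "{v \<in> V. dg v = 1} = {P 0, P d} \<union> (W - {w})"
    using leaves_subset[OF w] card_leaf_superset[OF w(1)] leaves finite_W by (intro card_subset_eq) auto
  then have leaf: "dg (P 0) = 1" "dg (P d) = 1" "\<And>x. x \<in> W - {w} \<Longrightarrow> dg x = 1" by auto
  have "(\<Sum>x\<in>W - {w}. dg x) = m - 2" using leaf(3) card_W w(1) finite_W by simp
  \<comment> \<open>The leaves in \<open>W\<close> account for only \<open>m - 2\<close> of the
    \<open>m\<close> edges off the path.\<close>
  then have two: "2 \<le> card (E `` {w} \<inter> P ` {..d})" using off_path_edges[OF w(1)] m_ge by linarith
  \<comment> \<open>The ends are leaves and already have a path neighbour, so \<open>w\<close>
    attaches to interior vertices. These then have degree at least 3, which leaves only
    \<open>a\<close> and \<open>b\<close>.\<close>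
  have nbr: "0 < j \<and> j < d \<and> P j \<in> {a, b}" if "j \<le> d" "(w, P j) \<in> E" for j
  proof -
    have wj: "(P j, w) \<in> E" using adj_sym that(2) by blast
    have wP: "w \<noteq> P k" if "k \<le> d" for k using w(1) that by (auto simp: W_def)
    have "j \<noteq> 0"
    proof
      assume "j = 0"
      then have "{P 1, w} \<subseteq> E `` {P 0}" using wj P_step[of 0] d_ge by auto
      then have "card {P 1, w} \<le> 1" using card_mono[OF finite_nbrs] leaf(1) by metis
      then show False using wP[of 1] d_ge by auto
    qed
    moreover have "j \<noteq> d"
    proof
      assume "j = d"
      then have "{P (d - 1), w} \<subseteq> E `` {P d}" using wj P_step[of "d - 1"] d_ge adj_sym by auto
      then have "card {P (d - 1), w} \<le> 1" using card_mono[OF finite_nbrs] leaf(2) by metis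
      then show False using wP[of "d - 1"] by auto
    qed
    ultimately have j: "0 < j" "j < d" using that(1) by auto
    have "{P (j - 1), P (Suc j), w} \<subseteq> E `` {P j}"
      using wj P_step[of "j - 1"] P_step[of j] adj_sym j by auto
    moreover have "P (j - 1) \<noteq> P (Suc j)" using P_inj[of "j - 1" "Suc j"] j by fastforce
    moreover have "w \<noteq> P (j - 1)" "w \<noteq> P (Suc j)" using j by (intro wP; linarith)+
    ultimately have "{P (j - 1), P (Suc j), w} \<subseteq> E `` {P j}" "card {P (j - 1), P (Suc j), w} = 3"
      by (auto simp: card_insert_if)
    then have "3 \<le> dg (P j)" using card_mono[OF finite_nbrs] by metis
    then have "P j \<in> {a, b}" using ab(6)[of "P j"] P_in[OF that(1)] by force
    with j show ?thesis by blast
  qed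
  then have "E `` {w} \<inter> P ` {..d} \<subseteq> {a, b}" by auto
  moreover have "card {a, b} = 2" using ab(3) by simp
  ultimately have "E `` {w} \<inter> P ` {..d} = {a, b}" using two by (intro card_seteq) auto
  then have "a \<in> E `` {w} \<inter> P ` {..d}" "b \<in> E `` {w} \<inter> P ` {..d}" by simp_all
  then obtain i j where "i \<le> d" "a = P i" "(w, a) \<in> E" "j \<le> d" "b = P j" "(w, b) \<in> E" by auto
  then have ij: "i \<le> d" "a = P i" "(w, P i) \<in> E" "j \<le> d" "b = P j" "(w, P j) \<in> E" by simp_all
  have "i \<noteq> j" using ab(3) ij by auto
  \<comment> \<open>The common neighbour \<open>w\<close> bounds the difference of the indices by 2;
    nonadjacency of \<open>a\<close> and \<open>b\<close> excludes 1.\<close>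
  moreover have "j \<le> i + 2" "i \<le> j + 2"
    using P_common[of i j w] P_common[of j i w] ij adj_sym by auto
  moreover have "j \<noteq> Suc i" using \<open>(a, b) \<notin> E\<close> P_step[of i] ij by auto
  moreover have "i \<noteq> Suc j" using \<open>(a, b) \<notin> E\<close> P_step[of j] ij adj_sym by auto
  ultimately have "j = i + 2 \<or> i = j + 2" by linarith
  then show ?thesis using that[of i j w] nbr[of i] nbr[of j] ij ab(4) w(1) by auto
qed

text \<open>Degree \<open>m + 1\<close> is the maximum for a path vertex and forces
  \<open>P i\<close> to be adjacent to all of \<open>W\<close>. Only preservation of arcs is shown;
  equal arc counts later make the map an isomorphism.\<close>

lemma U_graph_embedding:
  assumes i: "0 < i" "i + 2 < d" and deg: "dg (P i) = m + 1"
    and w: "w \<in> W" "(w, P i) \<in> E" "(w, P (i + 2)) \<in> E"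
  shows "\<exists>h. bij_betw h (pverts (U_graph (d + m) d i)) V \<and>
    (\<forall>(x, y)\<in>parcs (U_graph (d + m) d i). (h x, h y) \<in> E)"
proof -
  have "dg (P i) = card ({P (i - 1), P (Suc i)} \<union> W)"
  proof -
    have "P (i - 1) \<noteq> P (Suc i)" using P_inj[of "i - 1" "Suc i"] i by fastforce
    moreover have "{P (i - 1), P (Suc i)} \<inter> W = {}" using i by (auto simp: W_def)
    ultimately show ?thesis using deg card_W finite_W m_ge by (simp add: card_Un_disjoint)
  qed
  then have "E `` {P i} = {P (i - 1), P (Suc i)} \<union> W"
    using nbrs_P[of i] i finite_W by (intro card_subset_eq) auto
  then have hub: "(x, P i) \<in> E" if "x \<in> W" for x using that adj_sym by auto
  have "card (W - {w}) = card {1..m - 2}" using card_W w(1) finite_W by simp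
  then obtain e0 where e0: "bij_betw e0 {1..m - 2} (W - {w})"
    using finite_same_card_bij[of "{1..m - 2}" "W - {w}"] finite_W by auto
  \<comment> \<open>The last pendent vertex, which closes the cycle in \<open>U_graph\<close>, must
    go to \<open>w\<close>.\<close>
  define e where "e = e0(m - 1 := w)"
  have "bij_betw e {1..m - 2} (W - {w})" using e0 m_ge by (subst bij_betw_cong[of _ e e0]) (auto simp: e_def)
  moreover have "bij_betw e {m - 1} {w}" by (simp add: e_def)
  moreover have "(W - {w}) \<inter> {w} = {}" by auto
  ultimately have "bij_betw e ({1..m - 2} \<union> {m - 1}) ((W - {w}) \<union> {w})" by (rule bij_betw_combine)
  moreover have "{1..m - 2} \<union> {m - 1} = {1..m - 1}" using m_ge by auto
  ultimately have e: "bij_betw e {1..m - 1} W" using w(1) by (simp add: insert_absorb)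
  define h where "h x = (case x of PathV j \<Rightarrow> P j | PendV k \<Rightarrow> e k)" for x
  have "bij_betw h (PathV ` {0..d}) (P ` {..d})"
    using P_inj by (auto simp: bij_betw_def inj_on_def h_def image_image atLeast0AtMost)
  moreover have "bij_betw h (PendV ` {1..m - 1}) W"
    using e by (auto simp: bij_betw_def inj_on_def h_def image_image)
  moreover have "P ` {..d} \<inter> W = {}" by (auto simp: W_def)
  ultimately have "bij_betw h (PathV ` {0..d} \<union> PendV ` {1..m - 1}) (P ` {..d} \<union> W)"
    by (rule bij_betw_combine)
  moreover have "P ` {..d} \<union> W = V" using P_image by (auto simp: W_def)
  ultimately have bij: "bij_betw h (pverts (U_graph (d + m) d i)) V" by (simp add: pverts_U_graph)
  have "(h x, h y) \<in> E" if "(x, y) \<in> parcs (U_graph (d + m) d i)" for x y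
  proof -
    have "e k \<in> W" if "1 \<le> k" "k \<le> m - 1" for k using e that by (auto simp: bij_betw_def)
    moreover have "e (m - 1) = w" by (simp add: e_def)
    ultimately show ?thesis
      using that P_step hub w adj_sym m_ge
      by (cases x; cases y) (auto simp: h_def U_graph_arc_iff)
  qed
  with bij show ?thesis by blast
qed

lemma extremal_embedding:
  assumes "irregularity = 2 * extremal_value"
  shows "\<exists>i\<in>{1..d - 3}. \<exists>h. bij_betw h (pverts (U_graph (d + m) d i)) V \<and>
    (\<forall>(x, y)\<in>parcs (U_graph (d + m) d i). (h x, h y) \<in> E)"
proof -
  obtain i j w where *: "0 < i" "i < d" "0 < j" "j < d" "j = i + 2 \<or> i = j + 2" "dg (P i) = m + 1"
      "w \<in> W" "(w, P i) \<in> E" "(w, P j) \<in> E"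
    using extremal_structure[OF assms] .
  show ?thesis
  proof (cases "j = i + 2")
    case True
    then show ?thesis using U_graph_embedding[of i w] * by (intro bexI[of _ i]) auto
  next
    case False
    \<comment> \<open>Here \<open>i = j + 2\<close>; on the reversed path the two vertices have
      indices \<open>d - i\<close> and \<open>d - i + 2 = d - j\<close>.\<close>
    interpret R: geodesic_graph V E "\<lambda>j. P (d - j)" d m by (rule reversed)
    have "(\<lambda>j. P (d - j)) ` {..d} = P ` {..d}"
    proof (intro equalityI subsetI)
      fix x assume "x \<in> P ` {..d}"
      then obtain j where "j \<le> d" "x = P (d - (d - j))" by auto
      then show "x \<in> (\<lambda>j. P (d - j)) ` {..d}" by (intro image_eqI[of _ _ "d - j"]) auto
    qed auto
    then have "R.W = W" by (simp add: R.W_def W_def)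
    moreover have "d - (d - i) = i" "d - (d - i + 2) = j" "0 < d - i" "d - i + 2 < d" using * False by auto
    ultimately show ?thesis using R.U_graph_embedding[of "d - i" w] * False
      by (intro bexI[of _ "d - i"]) auto
  qed
qed

end

section \<open>Isomorphism invariance\<close>

lemma degree_eq_card: "degree G u = card (parcs G `` {u})"
proof -
  have "out_arcs (with_proj G) u = Pair u ` (parcs G `` {u})" by (force simp: out_arcs_def)
  then show ?thesis by (simp add: out_degree_def card_image inj_on_def)
qed

lemma (in graph_rel) SO1_eq_irregularity:
  assumes "E = parcs G"
  shows "SO1 G = real_of_int irregularity / 4"
  by (simp add: SO1_def irregularity_def degree_eq_card split_def assms[symmetric])

lemma digraph_iso_pairI:
  assumes "wf_digraph (with_proj G)" "inj_on h (pverts G)"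
    and "pverts H = h ` pverts G" "parcs H = map_prod h h ` parcs G"
  shows "digraph_iso (with_proj G) (with_proj H)"
proof -
  interpret wf_digraph "with_proj G" by fact
  let ?f = "\<lparr>iso_verts = h, iso_arcs = map_prod h h, iso_head = snd, iso_tail = fst\<rparr>"
  have "parcs G \<subseteq> pverts G \<times> pverts G" using tail_in_verts head_in_verts by force
  then have "inj_on (map_prod h h) (parcs G)"
    using inj_on_subset[OF map_prod_inj_on[OF assms(2,2)]] by blast
  then have "digraph_isomorphism ?f"
    using assms(1,2) by (simp add: digraph_isomorphism_def)
  moreover have "with_proj H = app_iso ?f (with_proj G)"
    using assms(3,4) by (simp add: app_iso_def with_proj_def)
  ultimately show ?thesis unfolding digraph_iso_def by blast
qed

text \<open>A library isomorphism carries a separate arc map; compatibility with tails and heads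
  makes it act on both ends of an arc as the vertex map, which preserves degrees.\<close>

lemma SO1_digraph_iso:
  assumes "wf_digraph (with_proj G)" "digraph_iso (with_proj G) (with_proj H)"
  shows "SO1 H = SO1 G"
proof -
  interpret wf_digraph "with_proj G" by fact
  obtain f where f: "digraph_isomorphism f" "with_proj H = app_iso f (with_proj G)"
    using assms(2) unfolding digraph_iso_def by blast
  have arcs: "parcs H = iso_arcs f ` parcs G" using arg_cong[OF f(2), of arcs] by simp
  have ends: "fst (iso_arcs f e) = iso_verts f (fst e)" "snd (iso_arcs f e) = iso_verts f (snd e)"
    if "e \<in> parcs G" for e
    using that iso_verts_tail[OF f(1), of e] iso_verts_head[OF f(1), of e]
      arg_cong[OF f(2), of tail] arg_cong[OF f(2), of head] by auto
  have deg: "degree H (iso_verts f (fst e)) = degree G (fst e)"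
      "degree H (iso_verts f (snd e)) = degree G (snd e)" if "e \<in> parcs G" for e
    using out_degree_app_iso_eq[OF f(1)] tail_in_verts head_in_verts that by (simp_all add: f(2))
  have "inj_on (iso_arcs f) (parcs G)" using digraph_isomorphism_inj_on_arcs[OF f(1)] by simp
  then show ?thesis
    unfolding SO1_def arcs using ends deg by (simp add: sum.reindex split_def cong: sum.cong)
qed

section \<open>The bound and its equality case for unicyclic graphs\<close>

theorem theorem3p2:
  fixes G :: "'a pair_pre_digraph" and n d :: nat
  assumes "4 \<le> d" and "d \<le> n - 2"
    and "unicyclic G"
    and "card (pverts G) = n"
    and "diameter G = ereal (real d)"
  shows "SO1 G \<le> 1 / 2 * ((real n - real d) * (real n - real d + 1) * (real n - real d + 2) + 12)
    \<and> (SO1 G = 1 / 2 * ((real n - real d) * (real n - real d + 1) * (real n - real d + 2) + 12)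
        \<longleftrightarrow> (\<exists>i\<in>{1..d - 3}. digraph_iso (with_proj G) (with_proj (U_graph n d i))))"
proof -
  interpret pair_graph G using assms(3) by (simp add: unicyclic_def)
  have con: "Digraph_Component.connected (with_proj G)"
    and uniq: "\<exists>!C. C \<in> cycle_edge_sets G" using assms(3) by (auto simp: unicyclic_def)
  define m where "m = n - d"
  \<comment> \<open>Since \<open>4 \<le> d\<close>, the truncated difference \<open>n - 2\<close> is
    positive, so \<open>d + 2 \<le> n\<close>.\<close>
  have n: "n = d + m" "2 \<le> m" using assms(1,2) by (auto simp: m_def)
  obtain P where P: "\<And>j. j \<le> d \<Longrightarrow> P j \<in> pverts G" "\<And>j. j < d \<Longrightarrow> (P j, P (Suc j)) \<in> parcs G"
    "\<And>c i j. \<lbrakk>i \<le> d; j \<le> d; (P i, P j) \<in> parcs G ^^ c\<rbrakk> \<Longrightarrow> j \<le> i + c"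
    by (rule ex_geodesic[OF con assms(5)]) (rule that, blast+)
  obtain p where p: "cycle p" "3 \<le> length p"
    using uniq unfolding cycle_edge_sets_def by blast
  have "2 * card (pverts G) \<le> card (parcs G)"
    using P(1)[of 0] p connected_relpow[OF con] by (intro card_arcs_ge_if_cycle[of "P 0"]) auto
  then have card_arcs: "card (parcs G) = 2 * card (pverts G)"
    using card_arcs_le_if_unique_cycle[OF uniq] by simp
  interpret geodesic_graph "pverts G" "parcs G" P d m
  proof
    show "finite (pverts G)" by (rule pair_finite_verts)
    show "parcs G \<subseteq> pverts G \<times> pverts G" by (auto simp: in_arcsD1 in_arcsD2)
    show "sym (parcs G)" using arcs_symmetric by (auto intro: symI)
    show "irrefl (parcs G)" using no_loops' by (auto simp: irrefl_def)
    show "parcs G `` {x} \<noteq> {}" if x: "x \<in> pverts G" for x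
    proof -
      \<comment> \<open>A walk from \<open>x\<close> to any other vertex begins with an arc at
        \<open>x\<close>.\<close>
      have "\<exists>y\<in>pverts G. y \<noteq> x"
      proof (rule ccontr)
        assume "\<not> ?thesis"
        then have "pverts G \<subseteq> {x}" by auto
        then show False using card_mono[of "{x}" "pverts G"] assms(4) n by simp
      qed
      then obtain y k where "(x, y) \<in> parcs G ^^ k" "y \<noteq> x" using connected_relpow[OF con x] by blast
      then show ?thesis by (cases k) (auto simp del: relpow.simps(2) dest!: relpow_Suc_D2)
    qed
    show "j \<le> d \<Longrightarrow> P j \<in> pverts G" for j by (rule P(1))
    show "j < d \<Longrightarrow> (P j, P (Suc j)) \<in> parcs G" for j by (rule P(2))
    show "\<lbrakk>i \<le> d; j \<le> d; P i = P j\<rbrakk> \<Longrightarrow> i = j" for i j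
      using P(3)[of i j 0] P(3)[of j i 0] by simp
    show "\<lbrakk>i \<le> d; j \<le> d; (P i, P j) \<in> parcs G\<rbrakk> \<Longrightarrow> j \<le> Suc i" for i j
      using P(3)[of i j 1] by simp
    show "\<lbrakk>i \<le> d; j \<le> d; (P i, x) \<in> parcs G; (x, P j) \<in> parcs G\<rbrakk> \<Longrightarrow> j \<le> i + 2" for i j x
      using P(3)[of i j 2] by (auto simp: numeral_2_eq_2)
  qed (use assms n card_arcs in auto)
  have SO1: "SO1 G = real_of_int irregularity / 4" by (rule SO1_eq_irregularity) simp
  have bound: "1 / 2 * ((real n - real d) * (real n - real d + 1) * (real n - real d + 2) + 12)
      = real_of_int (2 * extremal_value) / 4"
    by (simp add: n extremal_value_def)
  have "SO1 G \<le> real_of_int (2 * extremal_value) / 4"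
    unfolding SO1 using irregularity_bound by linarith
  moreover have "SO1 G = real_of_int (2 * extremal_value) / 4 \<longleftrightarrow>
      (\<exists>i\<in>{1..d - 3}. digraph_iso (with_proj G) (with_proj (U_graph n d i)))"
  proof
    assume "SO1 G = real_of_int (2 * extremal_value) / 4"
    then have "irregularity = 2 * extremal_value" unfolding SO1 by linarith
    then obtain i h where i: "i \<in> {1..d - 3}" and h: "bij_betw h (pverts (U_graph n d i)) (pverts G)"
        "\<forall>(x, y)\<in>parcs (U_graph n d i). (h x, h y) \<in> parcs G"
      using extremal_embedding unfolding n(1) by blast
    interpret U: U_graph_params d m i using i n(2) by unfold_locales auto
    let ?U = "U_graph n d i"
    have "inj_on (map_prod h h) (pverts ?U \<times> pverts ?U)"
      using h(1) by (intro map_prod_inj_on) (auto simp: bij_betw_def)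
    then have "inj_on (map_prod h h) (parcs ?U)"
      using U.E_subset inj_on_subset unfolding n(1) by blast
    \<comment> \<open>Both graphs have \<open>2 * n\<close> arcs, so the injective image of the arcs
      of \<open>U_graph\<close> exhausts those of \<open>G\<close>.\<close>
    then have "card (map_prod h h ` parcs ?U) = card (parcs G)"
      using U.card_EU card_arcs assms(4) by (simp add: card_image n)
    moreover have "map_prod h h ` parcs ?U \<subseteq> parcs G" using h(2) by auto
    ultimately have img: "map_prod h h ` parcs ?U = parcs G"
      using pair_finite_arcs by (intro card_subset_eq)
    \<comment> \<open>The isomorphism is required from \<open>G\<close> to \<open>U_graph\<close>,
      hence the inverse of \<open>h\<close>.\<close>
    let ?g = "inv_into (pverts ?U) h"
    have g: "bij_betw ?g (pverts G) (pverts ?U)" using h(1) by (rule bij_betw_inv_into)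
    have "map_prod ?g ?g (map_prod h h e) = e" if "e \<in> parcs ?U" for e
      using that U.E_subset bij_betw_inv_into_left[OF h(1)] unfolding n(1) by (cases e) auto
    then have "parcs ?U = map_prod ?g ?g ` map_prod h h ` parcs ?U" by (force simp: image_iff)
    then have "digraph_iso (with_proj G) (with_proj ?U)"
      using g wf_digraph unfolding img by (intro digraph_iso_pairI[of G ?g]) (auto simp: bij_betw_def)
    with i show "\<exists>i\<in>{1..d - 3}. digraph_iso (with_proj G) (with_proj (U_graph n d i))" by blast
  next
    assume "\<exists>i\<in>{1..d - 3}. digraph_iso (with_proj G) (with_proj (U_graph n d i))"
    then obtain i where i: "i \<in> {1..d - 3}" "digraph_iso (with_proj G) (with_proj (U_graph n d i))"
      by blast
    interpret U: U_graph_params d m i using i(1) n(2) by unfold_locales auto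
    have "SO1 G = SO1 (U_graph n d i)" using SO1_digraph_iso[OF _ i(2)] wf_digraph by simp
    also have "\<dots> = real_of_int U.irregularity / 4"
      by (rule U.SO1_eq_irregularity) (simp add: n)
    finally show "SO1 G = real_of_int (2 * extremal_value) / 4"
      by (simp only: U.irregularity_U extremal_value_def)
  qed
  ultimately show ?thesis unfolding bound by blast
qed

end
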